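(* Let $G=(V,E)$ be a directed unweighted graph with $n$ vertices and let $\beta \ge 1$ be an integer hopbound parameter. Run the following greedy algorithm: start with $H \gets \emptyset$; while $H$ does not have hopbound at most $\beta$, add to $H$ an edge $e$ of the transitive closure of $G$ that maximizes the decrease of the potential \[ \phi(H) := \sum_{\substack{(s,t) \in \mathrm{TC}(G)\\ \mathrm{dist}_{G\cup H}(s,t) \ge \beta}} \mathrm{dist}_{G\cup H}(s,t). \] Then the output $H$ is a shortcut set of $G$ with hopbound $\beta$ and \[ |H| \le \widetilde{O}\!\left(\frac{n^{3/2}}{\beta^{3/2}} + \frac{n^2}{\beta^3}\right). \]
   Context: $\mathrm{TC}(G)$ denotes the transitive closure of $G$: the set of pairs $(u,v)$ such that there is a directed path from $u$ to $v$ in $G$. All edges are unweighted, so $\mathrm{dist}_{G\cup H}(s,t)$ is the number of edges on a shortest $s\to t$ path in the graph $G$ with the edges of $H$ added. A shortcut set with hopbound $\beta$ is a set $H \subseteq \mathrm{TC}(G)$ of additional unweighted edges such that every pair $(s,t)\in\mathrm{TC}(G)$ satisfies $\mathrm{dist}_{G\cup H}(s,t)\le\beta$. The notation $\widetilde{O}(\cdot)$ hides factors polylogarithmic in $n$. Ties in the choice of the greedy edge are broken arbitrarily. *)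

theory Defs
  imports "HOL-Analysis.Analysis" "Graph_Theory.Pair_Digraph"
begin

(* Reflexive: (v, v) is included via the empty path.  Such pairs have distance 0, so they
   affect neither the hopbound nor the potential below. *)
definition TC :: "'a pair_pre_digraph \<Rightarrow> ('a \<times> 'a) set" where
  "TC G = {(u, v). u \<rightarrow>\<^sup>*\<^bsub>with_proj G\<^esub> v}"

definition add_edges :: "'a pair_pre_digraph \<Rightarrow> ('a \<times> 'a) set \<Rightarrow> 'a pair_pre_digraph" where
  "add_edges G H = G\<lparr>parcs := parcs G \<union> H\<rparr>"

(* Number of edges on a shortest path; unspecified (LEAST over an empty predicate) if t is not
   reachable from s.  It is only used for pairs in TC G. *)
definition hop_dist :: "'a pair_pre_digraph \<Rightarrow> 'a \<Rightarrow> 'a \<Rightarrow> nat" where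
  "hop_dist G s t = (LEAST k. \<exists>p. pre_digraph.apath (with_proj G) s p t \<and> length p = k)"

definition has_hopbound :: "'a pair_pre_digraph \<Rightarrow> nat \<Rightarrow> ('a \<times> 'a) set \<Rightarrow> bool" where
  "has_hopbound G \<beta> H \<longleftrightarrow> (\<forall>(s, t) \<in> TC G. hop_dist (add_edges G H) s t \<le> \<beta>)"

definition shortcut_set :: "'a pair_pre_digraph \<Rightarrow> nat \<Rightarrow> ('a \<times> 'a) set \<Rightarrow> bool" where
  "shortcut_set G \<beta> H \<longleftrightarrow> H \<subseteq> TC G \<and> has_hopbound G \<beta> H"

definition potential :: "'a pair_pre_digraph \<Rightarrow> nat \<Rightarrow> ('a \<times> 'a) set \<Rightarrow> nat" where
  "potential G \<beta> H =
     (\<Sum>(s, t) \<in> {(s, t). (s, t) \<in> TC G \<and> hop_dist (add_edges G H) s t \<ge> \<beta>}.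
        hop_dist (add_edges G H) s t)"

(* One iteration of the while loop.  This is a relation rather than a function because ties
   between maximizing edges may be broken arbitrarily. *)
definition greedy_step ::
  "'a pair_pre_digraph \<Rightarrow> nat \<Rightarrow> ('a \<times> 'a) set \<Rightarrow> ('a \<times> 'a) set \<Rightarrow> bool" where
  "greedy_step G \<beta> H H' \<longleftrightarrow>
     \<not> has_hopbound G \<beta> H \<and>
     (\<exists>e. is_arg_max (\<lambda>e. int (potential G \<beta> H) - int (potential G \<beta> (insert e H)))
            (\<lambda>e. e \<in> TC G) e \<and>
          H' = insert e H)"

(* A final state is one from which no iteration is possible.  It is not assumed to satisfy the
   hopbound: a state in which the loop guard holds but no edge can be chosen would also count. *)
definition greedy_output :: "'a pair_pre_digraph \<Rightarrow> nat \<Rightarrow> ('a \<times> 'a) set \<Rightarrow> bool" where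
  "greedy_output G \<beta> H \<longleftrightarrow>
     (greedy_step G \<beta>)\<^sup>*\<^sup>* {} H \<and> \<not> (\<exists>H'. greedy_step G \<beta> H H')"

definition greedy_terminates :: "'a pair_pre_digraph \<Rightarrow> nat \<Rightarrow> bool" where
  "greedy_terminates G \<beta> \<longleftrightarrow>
     \<not> (\<exists>S :: nat \<Rightarrow> ('a \<times> 'a) set. S 0 = {} \<and> (\<forall>i. greedy_step G \<beta> (S i) (S (Suc i))))"

end

theory Submission
  imports Defs "HOL-Library.Discrete_Functions"
begin

text \<open>
  Say that an edge \<open>(u, v)\<close> of the transitive closure gains \<open>d(s, t) - (d(s, u) + 1 + d(v, t))\<close>
  on the pair \<open>(s, t)\<close>, where \<open>d\<close> is the current hop distance. Adding the edge lowers the potential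
  at least by its total gain over the pairs at distance at least \<open>\<beta>\<close>. So it suffices that some
  edge gains a fraction \<open>1/K\<close> of the potential, where \<open>K\<close> is the claimed bound up to logarithms:
  the potential then decays geometrically from at most \<open>n\<^sup>3\<close>, and it is at least 1 as long as the loop runs.

  To find this edge, average over a few explicit families of edges. Take pairs with distances
  in a dyadic range, and cut their geodesics into blocks of \<open>k\<close> vertices, where \<open>k\<close> is
  the distance up to a logarithm. Sort the vertices
  into logarithmically many classes by the size of their strong component, the components with at
  least \<open>k\<close> vertices forming one class. By pigeonhole, each geodesic has two distant blocks in which
  the same class is frequent. Let \<open>R\<close> be the maximum of 1 and the square root of \<open>k\<^sup>3/n\<close>.

  For large components, partition them into \<open>O(n/k)\<close> parts of size at most \<open>k\<close>, each with a centre
  at distance at most \<open>2k\<close> from (or to) all of its vertices. If a block meets many of its parts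
  densely, all the pairs within a part form a good family; if both blocks are sparse, they meet many
  parts, and the pairs of centres do.

  For components with about \<open>\<mu>\<close> vertices, the dense case is the same. Otherwise cover the
  components greedily by blocks \<open>y\<close> of geodesics. Since components are visited by all paths in the same order, the
  second block of a geodesic either accompanies some of these \<open>y\<close> for a length much larger than
  \<open>\<mu> + R\<close>, and then the edges along \<open>y\<close> that skip about \<open>\<mu> + R\<close> vertices are good; or it
  meets many different \<open>y\<close>, and then one uses the edges from a component to the first
  vertex of \<open>y\<close> that is reachable from it.
\<close>

section \<open>Gains of edges in an abstract hop distance\<close>

text \<open>Only the hop distance on pairs of the transitive closure is kept of the current graph,
  so that reversing all edges gives another instance. \<open>\<delta>\<close> is constrained only
  where \<open>T\<close> holds, and the edges are visible only through the geodesics of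
  \<open>geodesic_ex\<close>.\<close>

locale hop_metric =
  fixes V :: "'a set" and T :: "'a \<Rightarrow> 'a \<Rightarrow> bool" and \<delta> :: "'a \<Rightarrow> 'a \<Rightarrow> nat"
  assumes finite_V: "finite V"
    and T_in_V: "T u v \<Longrightarrow> u \<in> V \<and> v \<in> V"
    and T_refl: "u \<in> V \<Longrightarrow> T u u"
    and T_trans: "T u v \<Longrightarrow> T v w \<Longrightarrow> T u w"
    and d_refl: "u \<in> V \<Longrightarrow> \<delta> u u = 0"
    and d_tri: "T u v \<Longrightarrow> T v w \<Longrightarrow> \<delta> u w \<le> \<delta> u v + \<delta> v w"
    and geodesic_ex: "T u v \<Longrightarrow> \<exists>x :: nat \<Rightarrow> 'a. x 0 = u \<and> x (\<delta> u v) = v \<and>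
          (\<forall>i j. i \<le> j \<longrightarrow> j \<le> \<delta> u v \<longrightarrow> T (x i) (x j) \<and> \<delta> (x i) (x j) = j - i)"
begin

definition geod :: "(nat \<Rightarrow> 'a) \<Rightarrow> nat \<Rightarrow> bool" where
  "geod x l \<longleftrightarrow> (\<forall>i j. i \<le> j \<longrightarrow> j \<le> l \<longrightarrow> T (x i) (x j) \<and> \<delta> (x i) (x j) = j - i)"

definition scc :: "'a \<Rightarrow> 'a set" where
  "scc w = {v. T v w \<and> T w v}"

text \<open>Subtraction on naturals truncates: an edge that offers no shorter route gains 0, like an
  edge that the pair cannot use.\<close>

definition gain :: "'a \<times> 'a \<Rightarrow> 'a \<times> 'a \<Rightarrow> nat" where
  "gain e p = (if T (fst p) (fst e) \<and> T (snd e) (snd p)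
     then \<delta> (fst p) (snd p) - (\<delta> (fst p) (fst e) + 1 + \<delta> (snd e) (snd p)) else 0)"

text \<open>A geodesic read backwards is a geodesic of the reversed distance. This turns centres
  near to which all vertices lie into centres near from which they lie.\<close>

lemma dual: "hop_metric V (\<lambda>u v. T v u) (\<lambda>u v. \<delta> v u)"
proof
  fix u v assume "T v u"
  then obtain x :: "nat \<Rightarrow> 'a" where x: "x 0 = v" "x (\<delta> v u) = u"
    "\<And>i j. i \<le> j \<Longrightarrow> j \<le> \<delta> v u \<Longrightarrow> T (x i) (x j) \<and> \<delta> (x i) (x j) = j - i"
    using geodesic_ex by blast
  have "T (x (\<delta> v u - j)) (x (\<delta> v u - i)) \<and> \<delta> (x (\<delta> v u - j)) (x (\<delta> v u - i)) = j - i"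
    if "i \<le> j" "j \<le> \<delta> v u" for i j
    using x(3)[of "\<delta> v u - j" "\<delta> v u - i"] that by auto
  then show "\<exists>x. x 0 = u \<and> x (\<delta> v u) = v \<and>
      (\<forall>i j. i \<le> j \<longrightarrow> j \<le> \<delta> v u \<longrightarrow> T (x j) (x i) \<and> \<delta> (x j) (x i) = j - i)"
    by (intro exI[of _ "\<lambda>i. x (\<delta> v u - i)"]) (use x in auto)
next
  fix u v w assume "T v u" "T w v"
  then show "\<delta> w u \<le> \<delta> v u + \<delta> w v" using d_tri[of w v u] by simp
next
  fix u v w assume "T v u" "T w v"
  then show "T w u" using T_trans[of w v u] by simp
next
  fix u v assume "T v u" then show "u \<in> V \<and> v \<in> V" using T_in_V[of v u] by simp
qed (simp_all add: finite_V T_refl d_refl)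

lemma geodD: "geod x l \<Longrightarrow> i \<le> j \<Longrightarrow> j \<le> l \<Longrightarrow> T (x i) (x j) \<and> \<delta> (x i) (x j) = j - i"
  unfolding geod_def by blast

lemma geod_inj:
  assumes "geod x l"
  shows "inj_on x {..l}"
proof (rule linorder_inj_onI)
  fix i j assume "i < j" "i \<in> {..l}" "j \<in> {..l}"
  then have "\<delta> (x i) (x j) = j - i" "\<delta> (x i) (x i) = i - i"
    using geodD[OF assms, of i j] geodD[OF assms, of i i] by simp_all
  with \<open>i < j\<close> show "x i \<noteq> x j" by (intro notI) simp
qed auto

lemma geod_in_V: "geod x l \<Longrightarrow> i \<le> l \<Longrightarrow> x i \<in> V"
  using geodD[of x l i i] T_in_V[of "x i" "x i"] by simp

lemma geod_shift: "geod x l \<Longrightarrow> a + k \<le> l \<Longrightarrow> geod (\<lambda>i. x (a + i)) k"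
  unfolding geod_def by auto

lemma scc_refl: "w \<in> V \<Longrightarrow> w \<in> scc w"
  by (simp add: scc_def T_refl)

lemma scc_subset: "scc w \<subseteq> V"
  by (auto simp: scc_def dest: T_in_V)

lemma finite_scc: "finite (scc w)"
  using finite_subset[OF scc_subset finite_V] .

lemma scc_eq: "v \<in> scc w \<Longrightarrow> scc v = scc w"
proof -
  assume "v \<in> scc w"
  then have "T v w" "T w v" by (simp_all add: scc_def)
  then have "T u v \<longleftrightarrow> T u w" "T v u \<longleftrightarrow> T w u" for u
    using T_trans[of u v w] T_trans[of u w v] T_trans[of v w u] T_trans[of w v u] by auto
  then show ?thesis by (simp add: scc_def)
qed

lemma geod_scc_mid:
  assumes "geod x l" "i \<le> j" "j \<le> l" "x 0 \<in> scc w" "x l \<in> scc w"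
  shows "x j \<in> scc w"
proof -
  have "T (x 0) (x j)" "T (x j) (x l)" using assms geodD[OF assms(1)] by auto
  then show ?thesis using assms(4,5) T_trans[of "x j" "x l" w] T_trans[of w "x 0" "x j"]
    by (simp add: scc_def)
qed

text \<open>A geodesic between two vertices of a component stays inside it and repeats no vertex, so
  it has fewer edges than the component has vertices.\<close>

lemma scc_diam:
  assumes "u \<in> scc w" "v \<in> scc w"
  shows "T u v \<and> \<delta> u v < card (scc w)"
proof -
  have T: "T u v" using assms T_trans[of u w v] by (simp add: scc_def)
  then obtain x :: "nat \<Rightarrow> 'a" where x: "x 0 = u" "x (\<delta> u v) = v" "geod x (\<delta> u v)"
    using geodesic_ex unfolding geod_def by blast
  have "x ` {..\<delta> u v} \<subseteq> scc w"
    using geod_scc_mid[OF x(3), of 0] x assms by auto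
  then have "card (x ` {..\<delta> u v}) \<le> card (scc w)"
    by (rule card_mono[OF finite_scc])
  then show ?thesis using T card_image[OF geod_inj[OF x(3)]] by simp
qed

text \<open>The detour follows the geodesic to \<open>x i\<close>, pays at most
  \<open>\<alpha>\<close> to reach \<open>u\<close>, takes the edge, and pays at most
  \<open>\<gamma>\<close> to rejoin the geodesic at \<open>x j\<close>. Of the \<open>j - i\<close>
  skipped steps, at least \<open>\<kappa>\<close> are left over.\<close>

lemma gain_geod:
  assumes x: "geod x (\<delta> s t)" "x 0 = s" "x (\<delta> s t) = t"
    and ij: "i \<le> \<delta> s t" "j \<le> \<delta> s t"
    and u: "T (x i) u" "\<delta> (x i) u \<le> \<alpha>" and v: "T v (x j)" "\<delta> v (x j) \<le> \<gamma>"
    and \<kappa>: "i + \<alpha> + 1 + \<gamma> + \<kappa> \<le> j"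
  shows "\<kappa> \<le> gain (u, v) (s, t)"
proof -
  have 1: "T s (x i)" "\<delta> s (x i) = i" using geodD[OF x(1), of 0 i] ij x by auto
  have 2: "T (x j) t" "\<delta> (x j) t = \<delta> s t - j" using geodD[OF x(1), of j "\<delta> s t"] ij x by auto
  have "T s u" "\<delta> s u \<le> i + \<alpha>" using d_tri[OF 1(1) u(1)] T_trans[OF 1(1) u(1)] 1 u by auto
  moreover have "T v t" "\<delta> v t \<le> \<gamma> + (\<delta> s t - j)"
    using d_tri[OF v(1) 2(1)] T_trans[OF v(1) 2(1)] 2 v by auto
  ultimately show ?thesis using ij \<kappa> by (simp add: gain_def)
qed

text \<open>The set \<open>\<Gamma>'\<close> is the part of \<open>\<Gamma>\<close> that is served by one family of edges; by averaging over
  the family, one of its edges witnesses \<open>cheap\<close>, however the sets \<open>\<Gamma>'\<close> overlap.\<close>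

definition cheap :: "('a \<times> 'a) set \<Rightarrow> real \<Rightarrow> ('a \<times> 'a) set \<Rightarrow> bool" where
  "cheap \<Gamma> \<tau> \<Gamma>' \<longleftrightarrow> (\<exists>e. T (fst e) (snd e) \<and>
     \<tau> * (\<Sum>p\<in>\<Gamma>'. real (\<delta> (fst p) (snd p))) \<le> (\<Sum>p\<in>\<Gamma>. real (gain e p)))"

text \<open>Averaging: were every edge of the family to gain less than the required amount on
  \<open>\<Gamma>\<close>, summing over the at most \<open>B\<close> edges would contradict
  \<open>g\<close>. The family is indexed, so an edge may occur repeatedly.\<close>

lemma cheapI:
  assumes \<Gamma>: "finite \<Gamma>" "\<Gamma>' \<subseteq> \<Gamma>" and V: "V \<noteq> {}" and I: "finite I"
    and e: "\<And>i. i \<in> I \<Longrightarrow> T (fst (e i)) (snd (e i))"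
    and B: "real (card I) \<le> B" "B > 0"
    and g: "\<And>p. p \<in> \<Gamma>' \<Longrightarrow> \<tau> * B * real (\<delta> (fst p) (snd p)) \<le> (\<Sum>i\<in>I. real (gain (e i) p))"
  shows "cheap \<Gamma> \<tau> \<Gamma>'"
proof (rule ccontr)
  assume c: "\<not> cheap \<Gamma> \<tau> \<Gamma>'"
  define W where "W = \<tau> * (\<Sum>p\<in>\<Gamma>'. real (\<delta> (fst p) (snd p)))"
  have small: "(\<Sum>p\<in>\<Gamma>. real (gain e p)) < W" if "T (fst e) (snd e)" for e
    using c that unfolding cheap_def W_def by (meson not_le)
  \<comment> \<open>The loop at any vertex is an admissible edge with nonnegative gain, which forces
    \<open>W > 0\<close>.\<close>
  obtain v where "v \<in> V" using V by blast
  then have "(\<Sum>p\<in>\<Gamma>. real (gain (v, v) p)) < W" using small[of "(v, v)"] T_refl[of v] by simp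
  moreover have "0 \<le> (\<Sum>p\<in>\<Gamma>. real (gain (v, v) p))" by (rule sum_nonneg) simp
  ultimately have "W > 0" by linarith
  have "B * W = (\<Sum>p\<in>\<Gamma>'. \<tau> * B * real (\<delta> (fst p) (snd p)))"
    by (simp add: W_def sum_distrib_left mult_ac)
  also have "\<dots> \<le> (\<Sum>p\<in>\<Gamma>'. \<Sum>i\<in>I. real (gain (e i) p))" using g by (rule sum_mono)
  also have "\<dots> \<le> (\<Sum>p\<in>\<Gamma>. \<Sum>i\<in>I. real (gain (e i) p))"
    by (rule sum_mono2) (use \<Gamma> in \<open>auto intro: sum_nonneg\<close>)
  also have "\<dots> = (\<Sum>i\<in>I. \<Sum>p\<in>\<Gamma>. real (gain (e i) p))" by (rule sum.swap)
  finally have le: "B * W \<le> (\<Sum>i\<in>I. \<Sum>p\<in>\<Gamma>. real (gain (e i) p))" .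
  show False
  proof (cases "I = {}")
    case True
    then show False using le mult_pos_pos[OF B(2) \<open>W > 0\<close>] by simp
  next
    case False
    have "(\<Sum>i\<in>I. \<Sum>p\<in>\<Gamma>. real (gain (e i) p)) < (\<Sum>i\<in>I. W)"
      by (rule sum_strict_mono) (use I False e small in auto)
    also have "\<dots> \<le> B * W" using B \<open>W > 0\<close> by simp
    finally show False using le by simp
  qed
qed

text \<open>One of the at most \<open>N\<close> sets carries at least a fraction
  \<open>1 / N\<close> of the weight of \<open>\<Gamma>\<close>, and the edge belonging to that set
  serves all of \<open>\<Gamma>\<close>. Overlaps only increase the sum of the weights.\<close>

lemma cheap_Union:
  assumes \<Gamma>: "finite \<Gamma>" "\<Gamma> \<noteq> {}" and F: "finite F" and sub: "\<Gamma> \<subseteq> (\<Union>f\<in>F. G f)"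
    and c: "\<And>f. f \<in> F \<Longrightarrow> cheap \<Gamma> \<tau> (G f)" and \<tau>: "\<tau> \<ge> 0" and fin: "\<And>f. f \<in> F \<Longrightarrow> finite (G f)"
    and N: "card F \<le> N"
  shows "cheap \<Gamma> (\<tau> / N) \<Gamma>"
proof (rule ccontr)
  assume nc: "\<not> cheap \<Gamma> (\<tau> / N) \<Gamma>"
  let ?w = "\<lambda>A. \<Sum>p\<in>A. real (\<delta> (fst p) (snd p))"
  have Fne: "F \<noteq> {}" using \<Gamma> sub by auto
  then have N0: "N > 0" using N F by (metis card_gt_0_iff less_le_trans)
  have lt: "\<tau> * ?w (G f) < \<tau> / N * ?w \<Gamma>" if f: "f \<in> F" for f
  proof -
    obtain e where "T (fst e) (snd e)" "\<tau> * ?w (G f) \<le> (\<Sum>p\<in>\<Gamma>. real (gain e p))"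
      using c[OF f] unfolding cheap_def by blast
    moreover from this(1) have "(\<Sum>p\<in>\<Gamma>. real (gain e p)) < \<tau> / N * ?w \<Gamma>"
      using nc unfolding cheap_def by (meson not_le)
    ultimately show ?thesis by simp
  qed
  have "?w \<Gamma> \<le> ?w (\<Union>f\<in>F. G f)"
    by (rule sum_mono2) (use F fin sub in auto)
  also have "\<dots> \<le> (\<Sum>f\<in>F. ?w (G f))"
    using F fin
  proof (induction F rule: finite_induct)
    case (insert f F)
    have "?w (G f \<union> (\<Union>f\<in>F. G f)) \<le> ?w (G f) + ?w (\<Union>f\<in>F. G f)"
      using insert by (subst sum.union_inter[symmetric]) (auto intro: sum_nonneg)
    with insert show ?case by simp
  qed simp
  finally have "\<tau> * ?w \<Gamma> \<le> (\<Sum>f\<in>F. \<tau> * ?w (G f))"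
    using \<tau> by (simp add: sum_distrib_left[symmetric] mult_left_mono)
  also have "\<dots> < (\<Sum>f\<in>F. \<tau> / N * ?w \<Gamma>)" by (rule sum_strict_mono[OF F Fne lt])
  also have "\<dots> = card F / N * (\<tau> * ?w \<Gamma>)" by simp
  also have "\<dots> \<le> 1 * (\<tau> * ?w \<Gamma>)"
    by (rule mult_right_mono) (use N N0 \<tau> in \<open>auto intro!: mult_nonneg_nonneg sum_nonneg\<close>)
  finally show False by simp
qed

end

section \<open>Counting lemmas\<close>

text \<open>The summands are distinct naturals, so their sum is at least
  \<open>0 + 1 + \<dots> + (card A - 1)\<close>.\<close>

lemma sum_below_ge:
  fixes A :: "nat set"
  assumes "finite A" "\<And>i. i \<in> A \<Longrightarrow> i < b"
  shows "card A * (card A - 1) \<le> 2 * (\<Sum>i\<in>A. b - i - 1)"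
  using assms
proof (induction A rule: finite_linorder_min_induct)
  case (insert a A)
  have "A \<subseteq> {a<..<b}" using insert by auto
  then have "card A \<le> card {a<..<b}" by (rule card_mono[rotated]) simp
  then have c: "card A \<le> b - a - 1" by simp
  have "a \<notin> A" using insert.hyps by auto
  then have eq: "card (insert a A) = Suc (card A)" "(\<Sum>i\<in>insert a A. b - i - 1) = (b - a - 1) + (\<Sum>i\<in>A. b - i - 1)"
    using insert by simp_all
  have IH: "card A * (card A - 1) \<le> 2 * (\<Sum>i\<in>A. b - i - 1)" using insert by simp
  have "Suc (card A) * card A = 2 * card A + card A * (card A - 1)"
    by (cases "card A") simp_all
  then show ?case using IH c unfolding eq by simp
qed simp

text \<open>The gap of a pair is at least the number of elements of \<open>A\<close> strictly
  between, so the sum is at least the number of three-element subsets of \<open>A\<close>.\<close>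

lemma sum_pair_gaps_ge:
  fixes A :: "nat set"
  assumes "finite A"
  shows "card A * (card A - 1) * (card A - 2) \<le> 6 * (\<Sum>j\<in>A. \<Sum>i\<in>{i\<in>A. i < j}. j - i - 1)"
  using assms
proof (induction A rule: finite_linorder_max_induct)
  case (insert b A)
  have b: "b \<notin> A" "{i \<in> insert b A. i < b} = A" using insert by auto
  have "{i \<in> insert b A. i < j} = {i \<in> A. i < j}" if "j \<in> A" for j
    using insert that by auto
  then have eq: "(\<Sum>j\<in>insert b A. \<Sum>i\<in>{i\<in>insert b A. i < j}. j - i - 1)
      = (\<Sum>i\<in>A. b - i - 1) + (\<Sum>j\<in>A. \<Sum>i\<in>{i\<in>A. i < j}. j - i - 1)"
    using insert b by simp
  have *: "card A * (card A - 1) \<le> 2 * (\<Sum>i\<in>A. b - i - 1)"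
    using insert by (intro sum_below_ge) auto
  have "Suc (card A) * card A * (card A - 1)
      = 3 * (card A * (card A - 1)) + card A * (card A - 1) * (card A - 2)"
  proof (cases "card A")
    case (Suc m)
    then show ?thesis by (cases m) (simp_all add: algebra_simps)
  qed simp
  moreover have "card (insert b A) = Suc (card A)" using b insert by simp
  ultimately show ?case using * insert.IH unfolding eq by simp
qed simp

lemma sum_pair_gaps_ge_cube:
  fixes A :: "nat set"
  assumes A: "finite A" "3 \<le> card A"
  shows "real (card A) ^ 3 / 27 \<le> (\<Sum>j\<in>A. \<Sum>i\<in>{i\<in>A. i < j}. real (j - i - 1))"
proof -
  let ?h = "real (card A)"
  have "real (card A * (card A - 1) * (card A - 2))
      \<le> real (6 * (\<Sum>j\<in>A. \<Sum>i\<in>{i\<in>A. i < j}. j - i - 1))"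
    using sum_pair_gaps_ge[OF A(1)] by (rule of_nat_mono)
  then have "?h * (?h - 1) * (?h - 2) \<le> 6 * (\<Sum>j\<in>A. \<Sum>i\<in>{i\<in>A. i < j}. real (j - i - 1))"
    using A(2) by (simp add: of_nat_diff)
  \<comment> \<open>Up to a factor 3 this is \<open>27 * h * (h - 1) * (h - 2) - 6 * h ^ 3\<close>
    in factored form; the root at 3 shows that 27 is the exact constant for
    \<open>card A = 3\<close>.\<close>
  moreover have "0 \<le> ?h * ((?h - 3) * (7 * ?h - 6))"
    using A(2) by (intro mult_nonneg_nonneg) auto
  then have "6 * ?h ^ 3 \<le> 27 * (?h * (?h - 1) * (?h - 2))"
    by (simp add: algebra_simps power3_eq_cube)
  ultimately show ?thesis by simp
qed

lemma card_le_mult_card_image: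
  assumes "finite A" "\<And>b. b \<in> f ` A \<Longrightarrow> real (card {a\<in>A. f a = b}) \<le> h"
  shows "real (card A) \<le> h * real (card (f ` A))"
proof -
  have "real (card A) = (\<Sum>b\<in>f ` A. real (card {a\<in>A. f a = b}))"
    using sum.image_gen[OF assms(1), of "\<lambda>_. 1 :: real" f] by simp
  also have "\<dots> \<le> (\<Sum>b\<in>f ` A. h)" using assms(2) by (rule sum_mono)
  finally show ?thesis by (simp add: mult.commute)
qed

lemma mult_card_image_le_card:
  assumes "finite A" "\<And>b. b \<in> f ` A \<Longrightarrow> h \<le> real (card {a\<in>A. f a = b})"
  shows "h * real (card (f ` A)) \<le> real (card A)"
proof -
  have "h * real (card (f ` A)) = (\<Sum>b\<in>f ` A. h)" by simp
  also have "\<dots> \<le> (\<Sum>b\<in>f ` A. real (card {a\<in>A. f a = b}))" using assms(2) by (rule sum_mono)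
  also have "\<dots> = real (card A)"
    using sum.image_gen[OF assms(1), of "\<lambda>_. 1 :: real" f] by simp
  finally show ?thesis .
qed

text \<open>While some \<open>B\<close> in \<open>F\<close> is related to more than
  \<open>\<nu>\<close> elements not yet covered, choose it and let \<open>f\<close> send these
  elements to it. Each choice covers more than \<open>\<nu>\<close> new elements, which bounds the
  number of choices by \<open>card C / \<nu>\<close> for positive \<open>\<nu>\<close>; at the end
  every \<open>B\<close> has at most \<open>\<nu>\<close> uncovered elements.\<close>

lemma greedy_cover:
  fixes rel :: "'b \<Rightarrow> 'c set" and \<nu> :: real
  assumes "finite U" "\<nu> \<ge> 0"
  shows "\<exists>C f. C \<subseteq> U \<and> (\<forall>c\<in>C. f c \<in> F \<and> c \<in> rel (f c)) \<and> \<nu> * card (f ` C) \<le> card C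
     \<and> (\<forall>B\<in>F. card (rel B \<inter> U - C) \<le> \<nu>)"
  using assms(1)
proof (induction U rule: finite_psubset_induct)
  case (psubset U)
  show ?case
  proof (cases "\<exists>B\<in>F. real (card (rel B \<inter> U)) > \<nu>")
    case False
    then show ?thesis by (intro exI[of _ "{}"]) (auto simp: not_less)
  next
    case True
    then obtain B where B: "B \<in> F" "real (card (rel B \<inter> U)) > \<nu>" by blast
    let ?N = "rel B \<inter> U"
    have fN: "finite ?N" using psubset.hyps by auto
    have "?N \<noteq> {}" using B(2) assms(2) by (intro notI) auto
    then obtain C f where Cf: "C \<subseteq> U - ?N" "\<forall>c\<in>C. f c \<in> F \<and> c \<in> rel (f c)"
      "\<nu> * card (f ` C) \<le> card C" "\<forall>B\<in>F. card (rel B \<inter> (U - ?N) - C) \<le> \<nu>"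
      using psubset.IH[of "U - ?N"] by blast
    have fC: "finite C" using Cf(1) psubset.hyps finite_subset by blast
    define f' where "f' c = (if c \<in> ?N then B else f c)" for c
    have im: "f' ` (C \<union> ?N) \<subseteq> insert B (f ` C)" by (auto simp: f'_def)
    have "real (card (f' ` (C \<union> ?N))) \<le> real (Suc (card (f ` C)))"
      using card_mono[OF _ im] fC card_insert_le_m1[of "Suc (card (f ` C))" "f ` C" B]
      by (simp add: le_trans)
    then have "\<nu> * real (card (f' ` (C \<union> ?N))) \<le> \<nu> * real (Suc (card (f ` C)))"
      using assms(2) by (rule mult_left_mono)
    also have "\<dots> \<le> real (card C) + real (card ?N)"
      using Cf(3) B(2) by (simp add: algebra_simps)
    also have "\<dots> = real (card (C \<union> ?N))"
      using fC fN Cf(1) by (subst card_Un_disjoint) auto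
    finally have 1: "\<nu> * real (card (f' ` (C \<union> ?N))) \<le> real (card (C \<union> ?N))" .
    have 2: "\<forall>c\<in>C \<union> ?N. f' c \<in> F \<and> c \<in> rel (f' c)" using Cf(2) B by (auto simp: f'_def)
    have "rel B' \<inter> U - (C \<union> ?N) = rel B' \<inter> (U - ?N) - C" for B' by blast
    then have 3: "\<forall>B'\<in>F. card (rel B' \<inter> U - (C \<union> ?N)) \<le> \<nu>" using Cf(4) by simp
    have "C \<union> ?N \<subseteq> U" using Cf(1) by blast
    then show ?thesis using 1 2 3 by (intro exI[of _ "C \<union> ?N"] exI[of _ f'] conjI)
  qed
qed

lemma refine_fibres:
  fixes c :: "'a \<Rightarrow> 'b"
  assumes "finite W" "k \<ge> 1"
  shows "\<exists>g :: 'a \<Rightarrow> 'b \<times> nat. (\<forall>w\<in>W. fst (g w) = c w) \<and>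
     (\<forall>w\<in>W. card {v\<in>W. g v = g w} \<le> k) \<and> k * card (g ` W) \<le> card W + k * card (c ` W)"
proof -
  have "\<forall>b. \<exists>e :: 'a \<Rightarrow> nat. bij_betw e {w\<in>W. c w = b} {0..<card {w\<in>W. c w = b}}"
    by (intro allI ex_bij_betw_finite_nat) (simp add: assms)
  from choice[OF this] obtain e :: "'b \<Rightarrow> 'a \<Rightarrow> nat"
    where e: "\<And>b. bij_betw (e b) {w\<in>W. c w = b} {0..<card {w\<in>W. c w = b}}" by blast
  define g where "g w = (c w, e (c w) w div k)" for w
  have fib: "card {v\<in>W. g v = g w} \<le> k" if "w \<in> W" for w
  proof -
    let ?q = "e (c w) w div k"
    have sub: "{v\<in>W. g v = g w} \<subseteq> {v\<in>W. c v = c w}" by (auto simp: g_def)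
    have "inj_on (e (c w)) {v\<in>W. g v = g w}"
      using inj_on_subset[OF bij_betw_imp_inj_on[OF e] sub] .
    moreover have "e (c w) ` {v\<in>W. g v = g w} \<subseteq> {?q * k ..< ?q * k + k}"
    proof clarify
      fix v assume "g v = g w"
      then have "c v = c w \<and> e (c v) v div k = ?q" unfolding g_def prod.inject .
      then have q: "e (c w) v div k = ?q" by metis
      have "?q * k + e (c w) v mod k = e (c w) v"
        using div_mult_mod_eq[of "e (c w) v" k] unfolding q .
      moreover have "e (c w) v mod k < k" using assms(2) by simp
      ultimately have "?q * k \<le> e (c w) v" "e (c w) v < ?q * k + k" by linarith+
      then show "e (c w) v \<in> {?q * k ..< ?q * k + k}" by simp
    qed
    ultimately have "card {v\<in>W. g v = g w} \<le> card {?q * k ..< ?q * k + k}"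
      by (rule card_inj_on_le) simp
    then show ?thesis by simp
  qed
  have "k * card (g ` W) \<le> card W + k * card (c ` W)"
  proof -
    let ?n = "\<lambda>b. card {w\<in>W. c w = b}"
    have "g ` W \<subseteq> (SIGMA b:c ` W. {..?n b div k})"
    proof
      fix p assume "p \<in> g ` W"
      then obtain w where w: "w \<in> W" "p = g w" by blast
      then have "e (c w) w < ?n (c w)" using e[of "c w"] unfolding bij_betw_def by auto
      then have "e (c w) w div k \<le> ?n (c w) div k" by (intro div_le_mono) simp
      then show "p \<in> (SIGMA b:c ` W. {..?n b div k})" using w by (auto simp: g_def)
    qed
    then have "card (g ` W) \<le> card (SIGMA b:c ` W. {..?n b div k})"
      using assms(1) by (intro card_mono) auto
    also have "\<dots> = (\<Sum>b\<in>c ` W. ?n b div k + 1)" using assms(1) by (simp add: card_SigmaI)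
    finally have "k * card (g ` W) \<le> (\<Sum>b\<in>c ` W. k * (?n b div k + 1))"
      unfolding sum_distrib_left[symmetric] by (rule mult_le_mono2)
    also have "\<dots> \<le> (\<Sum>b\<in>c ` W. ?n b + k)" by (rule sum_mono) simp
    also have "\<dots> = card W + k * card (c ` W)"
      using sum.image_gen[OF assms(1), of "\<lambda>_. 1 :: nat" c] by (simp add: sum.distrib)
    finally show ?thesis .
  qed
  with fib show ?thesis by (intro exI[of _ g]) (auto simp: g_def)
qed

section \<open>Gains along one geodesic from edges within parts and between parts\<close>

context hop_metric
begin

definition joins :: "(nat \<Rightarrow> 'a) \<Rightarrow> 'a \<times> 'a \<Rightarrow> bool" where
  "joins x p \<longleftrightarrow> geod x (\<delta> (fst p) (snd p)) \<and> x 0 = fst p \<and> x (\<delta> (fst p) (snd p)) = snd p"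

lemma joins_gain:
  assumes "joins x p" "i \<le> \<delta> (fst p) (snd p)" "j \<le> \<delta> (fst p) (snd p)"
    and "T (x i) u" "\<delta> (x i) u \<le> \<alpha>" "T v (x j)" "\<delta> v (x j) \<le> \<gamma>" "i + \<alpha> + 1 + \<gamma> + \<kappa> \<le> j"
  shows "\<kappa> \<le> gain (u, v) p"
  using gain_geod[of x "fst p" "snd p" i j u \<alpha> v \<gamma> \<kappa>] assms unfolding joins_def by simp

text \<open>The condition \<open>T\<close> makes every member an admissible edge for an arbitrary
  partition \<open>g\<close>.\<close>

definition same_part :: "'a set \<Rightarrow> ('a \<Rightarrow> 'b) \<Rightarrow> ('a \<times> 'a) set" where
  "same_part W g = {e \<in> W \<times> W. g (fst e) = g (snd e) \<and> T (fst e) (snd e)}"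

lemma card_same_part:
  assumes "finite W" "\<And>w. w \<in> W \<Longrightarrow> card {v\<in>W. g v = g w} \<le> s"
  shows "card (same_part W g) \<le> card W * s"
proof -
  have "same_part W g \<subseteq> (SIGMA u:W. {v\<in>W. g v = g u})" by (auto simp: same_part_def)
  then have "card (same_part W g) \<le> card (SIGMA u:W. {v\<in>W. g v = g u})"
    using assms(1) by (intro card_mono) auto
  also have "\<dots> = (\<Sum>u\<in>W. card {v\<in>W. g v = g u})" using assms(1) by (simp add: card_SigmaI)
  also have "\<dots> \<le> card W * s" using sum_bounded_above[of W _ s] assms(2) by simp
  finally show ?thesis .
qed

text \<open>The edge from \<open>x i\<close> to \<open>x j\<close> gains \<open>j - i - 1\<close>. A
  part met by \<open>c \<ge> h\<close> indices therefore contributes at least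
  \<open>c ^ 3 / 27\<close>, which is at least \<open>h\<^sup>2 / 27\<close> per index; the bound is
  the sum over the parts.\<close>

lemma dense_gain:
  assumes x: "joins x p" and J: "J \<subseteq> {..\<delta> (fst p) (snd p)}" "x ` J \<subseteq> W" and W: "finite W"
    and h: "3 \<le> h" "\<And>j. j \<in> J \<Longrightarrow> h \<le> real (card {j'\<in>J. g (x j') = g (x j)})"
  shows "real (card J) * h\<^sup>2 / 27 \<le> (\<Sum>e\<in>same_part W g. real (gain e p))"
proof -
  let ?d = "\<delta> (fst p) (snd p)"
  let ?Q = "SIGMA j:J. {i\<in>J. g (x i) = g (x j) \<and> i < j}"
  let ?\<gamma> = "\<lambda>j. g (x j)"
  have gx: "geod x ?d" using x by (simp add: joins_def)
  have fJ: "finite J" using J(1) finite_subset by blast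
  let ?m = "\<lambda>(j, i). (x i, x j)"
  have inj: "inj_on ?m ?Q"
    using inj_onD[OF geod_inj[OF gx]] J(1) by (auto intro!: inj_onI)
  have sub: "?m ` ?Q \<subseteq> same_part W g"
  proof
    fix e assume "e \<in> ?m ` ?Q"
    then obtain i j where *: "e = (x i, x j)" "i \<in> J" "j \<in> J" "g (x i) = g (x j)" "i < j" by auto
    then have "T (x i) (x j)" using geodD[OF gx, of i j] J(1) by auto
    then show "e \<in> same_part W g" using * J(2) by (auto simp: same_part_def)
  qed
  have gap: "j - i - 1 \<le> gain (x i, x j) p" if "i \<in> J" "j \<in> J" "i < j" for i j
  proof -
    have "i \<le> ?d" "j \<le> ?d" using that J(1) by auto
    then show ?thesis using geodD[OF gx, of i i] geodD[OF gx, of j j] that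
      by (intro joins_gain[OF x, of i j _ 0 _ 0]) auto
  qed
  have "(\<Sum>j\<in>J. h\<^sup>2 / 27) \<le> (\<Sum>a\<in>?\<gamma> ` J. \<Sum>j\<in>{j\<in>J. ?\<gamma> j = a}. \<Sum>i\<in>{i\<in>J. ?\<gamma> i = a \<and> i < j}. real (j - i - 1))"
  proof (subst sum.image_gen[OF fJ, of _ ?\<gamma>], rule sum_mono)
    fix a assume a: "a \<in> ?\<gamma> ` J"
    let ?A = "{j\<in>J. ?\<gamma> j = a}"
    have hA: "h \<le> real (card ?A)" using a h(2) by auto
    have "real (card ?A) * h\<^sup>2 \<le> real (card ?A) * (real (card ?A))\<^sup>2"
      using hA h(1) by (intro mult_left_mono power_mono) auto
    then have "(\<Sum>j\<in>?A. h\<^sup>2 / 27) \<le> real (card ?A) ^ 3 / 27"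
      by (simp add: power3_eq_cube power2_eq_square mult_ac)
    also have "\<dots> \<le> (\<Sum>j\<in>?A. \<Sum>i\<in>{i\<in>?A. i < j}. real (j - i - 1))"
      using hA h(1) fJ by (intro sum_pair_gaps_ge_cube) auto
    also have "\<dots> = (\<Sum>j\<in>?A. \<Sum>i\<in>{i\<in>J. ?\<gamma> i = a \<and> i < j}. real (j - i - 1))"
      by (intro sum.cong) auto
    finally show "(\<Sum>j\<in>?A. h\<^sup>2 / 27) \<le> \<dots>" .
  qed
  also have "\<dots> = (\<Sum>a\<in>?\<gamma> ` J. \<Sum>j\<in>{j\<in>J. ?\<gamma> j = a}. \<Sum>i\<in>{i\<in>J. ?\<gamma> i = ?\<gamma> j \<and> i < j}. real (j - i - 1))"
    by (intro sum.cong) auto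
  also have "\<dots> = (\<Sum>j\<in>J. \<Sum>i\<in>{i\<in>J. ?\<gamma> i = ?\<gamma> j \<and> i < j}. real (j - i - 1))"
    by (rule sum.image_gen[OF fJ, symmetric])
  also have "\<dots> = (\<Sum>(j, i)\<in>?Q. real (j - i - 1))"
    using fJ by (subst sum.Sigma) auto
  also have "\<dots> \<le> (\<Sum>q\<in>?Q. real (gain (?m q) p))"
  proof (rule sum_mono, clarify)
    fix j i assume "i \<in> J" "j \<in> J" "i < j"
    then show "real (j - i - 1) \<le> real (gain (x i, x j) p)"
      using gap[of i j] by linarith
  qed
  also have "\<dots> = (\<Sum>e\<in>?m ` ?Q. real (gain e p))"
    by (subst sum.reindex[OF inj]) simp
  also have "\<dots> \<le> (\<Sum>e\<in>same_part W g. real (gain e p))"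
    by (rule sum_mono2[OF _ sub]) (use W in \<open>auto simp: same_part_def\<close>)
  finally show ?thesis by simp
qed

text \<open>Each pair of labels met by \<open>J1\<close> and \<open>J2\<close> names one edge, and
  this edge gains \<open>\<kappa>\<close>. The head \<open>v\<close> may depend on both labels
  because it has to be reachable from the tail, while the tail depends on the first label
  alone.\<close>

lemma cross_gain:
  assumes x: "joins x p" and J: "J1 \<subseteq> {..\<delta> (fst p) (snd p)}" "J2 \<subseteq> {..\<delta> (fst p) (snd p)}"
    and A: "finite A1" "finite A2" "g1 ` J1 \<subseteq> A1" "g2 ` J2 \<subseteq> A2"
    and u: "\<And>i. i \<in> J1 \<Longrightarrow> T (x i) (u (g1 i)) \<and> \<delta> (x i) (u (g1 i)) \<le> \<alpha>"
    and v: "\<And>i j. i \<in> J1 \<Longrightarrow> j \<in> J2 \<Longrightarrow> T (v (g1 i) (g2 j)) (x j) \<and> \<delta> (v (g1 i) (g2 j)) (x j) \<le> \<gamma>"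
    and gap: "\<And>i j. i \<in> J1 \<Longrightarrow> j \<in> J2 \<Longrightarrow> i + \<alpha> + 1 + \<gamma> + \<kappa> \<le> j"
  shows "real (card (g1 ` J1)) * real (card (g2 ` J2)) * real \<kappa>
     \<le> (\<Sum>(a, b)\<in>A1 \<times> A2. real (gain (u a, v a b) p))"
proof -
  have "real (card (g1 ` J1)) * real (card (g2 ` J2)) * real \<kappa> = (\<Sum>q\<in>g1 ` J1 \<times> g2 ` J2. real \<kappa>)"
    by (simp add: card_cartesian_product)
  also have "\<dots> \<le> (\<Sum>(a, b)\<in>g1 ` J1 \<times> g2 ` J2. real (gain (u a, v a b) p))"
  proof (rule sum_mono, clarify)
    fix i j assume ij: "i \<in> J1" "j \<in> J2"
    then show "real \<kappa> \<le> real (gain (u (g1 i), v (g1 i) (g2 j)) p)"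
      using joins_gain[OF x, of i j "u (g1 i)" \<alpha> "v (g1 i) (g2 j)" \<gamma> \<kappa>] u[of i] v[of i j] gap[of i j] J
      by auto
  qed
  also have "\<dots> \<le> (\<Sum>(a, b)\<in>A1 \<times> A2. real (gain (u a, v a b) p))"
    by (rule sum_mono2) (use A in auto)
  finally show ?thesis .
qed

end

section \<open>Centres of strong components\<close>

text \<open>These indices number the edges from \<open>y (i * q)\<close> to
  \<open>y (Suc i * q)\<close> along a block \<open>y\<close>; there are at most
  \<open>k / q\<close> of them.\<close>

lemma block_index:
  assumes "q > 0"
  shows "finite {i. Suc i * q < k} \<and> card {i. Suc i * q < k} * q \<le> k"
proof -
  have sub: "{i. Suc i * q < k} \<subseteq> {..<k div q}"
  proof clarify
    fix i assume "Suc i * q < k"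
    then have "Suc i \<le> k div q" using assms by (simp only: less_eq_div_iff_mult_less_eq)
    then show "i < k div q" by simp
  qed
  then have "card {i. Suc i * q < k} \<le> k div q" using card_mono[OF _ sub] by simp
  then have "card {i. Suc i * q < k} * q \<le> k div q * q" by (rule mult_le_mono1)
  then have "card {i. Suc i * q < k} * q \<le> k" using div_times_less_eq_dividend[of k q] by linarith
  then show ?thesis using finite_subset[OF sub] by simp
qed

context hop_metric
begin

lemma scc_path_in:
  assumes "geod x l" "x 0 \<in> scc w" "x l \<in> scc w"
  shows "x ` {..l} \<subseteq> scc w"
  using geod_scc_mid[OF assms(1), of 0 _ w] assms by auto

lemma card_geod_image:
  assumes "geod x l" "A \<subseteq> {..l}"
  shows "card (x ` A) = card A"
  using card_image[OF inj_on_subset[OF geod_inj[OF assms(1)] assms(2)]] .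

text \<open>The centres form a set \<open>Z\<close> of maximal cardinality such that at least \<open>k\<close> vertices per element
  of \<open>Z\<close> are within distance \<open>k\<close> of it: from a vertex farther than \<open>2k\<close> from \<open>Z\<close>, the
  first \<open>k\<close> steps of a geodesic would allow one more centre.\<close>

lemma centres:
  assumes k: "k \<ge> 1"
  defines "W \<equiv> {w \<in> V. k \<le> card (scc w)}"
  shows "\<exists>z. (\<forall>w\<in>W. z w \<in> scc w \<and> \<delta> w (z w) \<le> 2 * k) \<and> k * card (z ` W) \<le> card V"
proof -
  define cov where "cov Z = {w\<in>W. \<exists>z\<in>Z. z \<in> scc w \<and> \<delta> w z \<le> k}" for Z
  define Q where "Q Z \<longleftrightarrow> Z \<subseteq> W \<and> k * card Z \<le> card (cov Z)" for Z
  have fW: "finite W" using finite_V by (simp add: W_def)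
  have bound: "card Z \<le> card W" if "Q Z" for Z
    using that card_mono[OF fW] by (simp add: Q_def)
  have "Q {}" by (simp add: Q_def)
  then have "\<exists>Z. Q Z \<and> (\<forall>Z'. Q Z' \<longrightarrow> card Z' \<le> card Z)"
    by (rule ex_has_greatest_nat[of Q "{}" card "Suc (card W)"]) (simp_all add: bound less_Suc_eq_le)
  then obtain Z where Z: "Q Z" "\<And>Z'. Q Z' \<Longrightarrow> card Z' \<le> card Z" by blast
  have fZ: "finite Z" using Z(1) finite_subset[OF _ fW] unfolding Q_def by simp
  \<comment> \<open>Maximality of \<open>Z\<close>: \<open>k\<close> vertices of one component that
    are still uncovered and lie within distance \<open>k\<close> of \<open>z\<close> would allow
    \<open>z\<close> to be added.\<close>
  have no: False if w: "w \<in> W" and z: "z \<in> scc w" and N: "N \<subseteq> scc w" "k \<le> card N" "N \<inter> cov Z = {}"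
    "\<And>y. y \<in> N \<Longrightarrow> \<delta> y z \<le> k" for w z N
  proof -
    have sW: "scc w \<subseteq> W"
    proof
      fix y assume y: "y \<in> scc w"
      then have "y \<in> V" using scc_subset by blast
      then show "y \<in> W" using w scc_eq[OF y] by (simp add: W_def)
    qed
    have zs: "z \<in> scc y" if "y \<in> N" for y using scc_eq[of y w] that N(1) z by auto
    have Nc: "N \<subseteq> cov (insert z Z)" using N sW zs by (auto simp: cov_def)
    have fN: "finite N" using finite_subset[OF N(1) finite_scc] .
    have "N \<noteq> {}" using N(2) k by auto
    then obtain y where y: "y \<in> N" by blast
    have "z \<notin> Z"
    proof
      assume "z \<in> Z"
      moreover have "z \<in> scc y" "\<delta> y z \<le> k" "y \<in> W" using zs[OF y] N(1,4) y sW by blast+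
      ultimately have "y \<in> cov Z" unfolding cov_def by blast
      then show False using y N(3) by blast
    qed
    have fc: "finite (cov Z')" for Z' using fW by (simp add: cov_def)
    have "cov Z \<union> N \<subseteq> cov (insert z Z)" using Nc by (auto simp: cov_def)
    then have "card (cov Z \<union> N) \<le> card (cov (insert z Z))" by (rule card_mono[OF fc])
    moreover have "card (cov Z \<union> N) = card (cov Z) + card N"
      using N(3) fc fN by (subst card_Un_disjoint) auto
    ultimately have "k * card Z + k \<le> card (cov (insert z Z))"
      using Z(1) N(2) by (simp add: Q_def)
    then have "Q (insert z Z)"
      using Z(1) z sW \<open>z \<notin> Z\<close> fZ by (auto simp: Q_def)
    then show False using Z(2)[of "insert z Z"] \<open>z \<notin> Z\<close> fZ by simp
  qed
  have "\<exists>z\<in>Z. z \<in> scc w \<and> \<delta> w z \<le> 2 * k" if w: "w \<in> W" for w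
  proof (rule ccontr)
    assume nz: "\<not> (\<exists>z\<in>Z. z \<in> scc w \<and> \<delta> w z \<le> 2 * k)"
    have wV: "w \<in> V" "k \<le> card (scc w)" using w by (auto simp: W_def)
    note ww = scc_refl[OF wV(1)]
    show False
    proof (cases "Z \<inter> scc w = {}")
      case True
      have nc: "scc w \<inter> cov Z = {}"
      proof -
        have "y \<notin> cov Z" if "y \<in> scc w" for y
          using True scc_eq[OF that] by (auto simp: cov_def)
        then show ?thesis by blast
      qed
      \<comment> \<open>In a component without a centre, \<open>w\<close> itself can be added: it
        covers the whole component, or else the last \<open>k\<close> vertices before
        \<open>w\<close> on a geodesic from a vertex farther than \<open>k\<close>.\<close>
      show False
      proof (cases "\<forall>y\<in>scc w. \<delta> y w \<le> k")
        case True
        then show False using no[OF w ww, of "scc w"] nc wV by blast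
      next
        case False
        then obtain y where y: "y \<in> scc w" "\<delta> y w > k" by auto
        then have "T y w" by (simp add: scc_def)
        then obtain x :: "nat \<Rightarrow> 'a" where x: "x 0 = y" "x (\<delta> y w) = w" "geod x (\<delta> y w)"
          using geodesic_ex unfolding geod_def by blast
        let ?A = "{\<delta> y w - k..<\<delta> y w}"
        have 1: "x ` ?A \<subseteq> scc w" using scc_path_in[OF x(3), of w] x y ww by auto
        have "card (x ` ?A) = card ?A" by (rule card_geod_image[OF x(3)]) auto
        then have 2: "k \<le> card (x ` ?A)" using y by simp
        have "\<delta> v w \<le> k" if "v \<in> x ` ?A" for v
          using that geodD[OF x(3), of _ "\<delta> y w"] x(2) by auto
        then show False using no[OF w ww 1 2] nc 1 by blast
      qed
    next
      case False
      then obtain z0 where z0: "z0 \<in> Z" "z0 \<in> scc w" by blast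
      have far: "\<delta> w z0 > 2 * k" using nz z0 by auto
      have "T w z0" using z0 by (simp add: scc_def)
      then obtain x :: "nat \<Rightarrow> 'a" where x: "x 0 = w" "x (\<delta> w z0) = z0" "geod x (\<delta> w z0)"
        using geodesic_ex unfolding geod_def by blast
      let ?A = "{..<k}"
      have all: "x ` {..\<delta> w z0} \<subseteq> scc w" using scc_path_in[OF x(3), of w] x z0 ww by auto
      have 1: "x ` ?A \<subseteq> scc w" using all far by auto
      have xk: "x k \<in> scc w" using all far by auto
      have "card (x ` ?A) = card ?A" by (rule card_geod_image[OF x(3)]) (use far in auto)
      then have 2: "k \<le> card (x ` ?A)" by simp
      have 3: "\<delta> v (x k) \<le> k" if "v \<in> x ` ?A" for v
        using that geodD[OF x(3), of _ k] far by auto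
      \<comment> \<open>The new centre is \<open>x k\<close>, covering \<open>x 0\<close> to
        \<open>x (k - 1)\<close>. A centre already covering \<open>x i\<close> would be within
        \<open>i + k < 2 * k\<close> of \<open>w\<close>, contrary to \<open>nz\<close>.\<close>
      have "x i \<notin> cov Z" if i: "i < k" for i
      proof
        assume "x i \<in> cov Z"
        then obtain z where z: "z \<in> Z" "z \<in> scc (x i)" "\<delta> (x i) z \<le> k" by (auto simp: cov_def)
        have g: "T w (x i)" "\<delta> w (x i) = i" using geodD[OF x(3), of 0 i] i far x(1) by auto
        have "T (x i) z" using z(2) by (simp add: scc_def)
        then have "\<delta> w z \<le> i + k" using d_tri[OF g(1)] g(2) z(3) by fastforce
        moreover have "z \<in> scc w" using z(2) scc_eq[of "x i" w] 1 i by auto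
        ultimately show False using nz z(1) i by auto
      qed
      then have "x ` ?A \<inter> cov Z = {}" by auto
      then show False using no[OF w xk 1 2] 3 by blast
    qed
  qed
  then have "\<forall>w\<in>W. \<exists>z. z \<in> Z \<and> z \<in> scc w \<and> \<delta> w z \<le> 2 * k" by blast
  from bchoice[OF this] obtain z
    where z: "\<forall>w\<in>W. z w \<in> Z \<and> z w \<in> scc w \<and> \<delta> w (z w) \<le> 2 * k" by blast
  have "card (z ` W) \<le> card Z" using z fZ by (intro card_mono) auto
  moreover have "card (cov Z) \<le> card V" using finite_V by (intro card_mono) (auto simp: cov_def W_def)
  ultimately have "k * card (z ` W) \<le> card V"
    using Z(1) unfolding Q_def by (meson le_trans mult_le_mono2)
  with z show ?thesis by blast
qed

lemma centres_dual:
  assumes k: "k \<ge> 1"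
  defines "W \<equiv> {w \<in> V. k \<le> card (scc w)}"
  shows "\<exists>z. (\<forall>w\<in>W. z w \<in> scc w \<and> \<delta> (z w) w \<le> 2 * k) \<and> k * card (z ` W) \<le> card V"
proof -
  interpret D: hop_metric V "\<lambda>u v. T v u" "\<lambda>u v. \<delta> v u" by (rule dual)
  have "D.scc w = scc w" for w unfolding D.scc_def scc_def by blast
  then show ?thesis using D.centres[OF k] unfolding W_def by simp
qed

text \<open>The geodesic \<open>x\<close> shares small components with the block \<open>y\<close> at
  two distant indices. Changing between the two costs at most \<open>M\<close> at either end, so
  \<open>b - a\<close> and \<open>j2 - j1\<close> differ by at most \<open>2 * M\<close>, and each
  edge skipping \<open>q\<close> steps of \<open>y\<close> between \<open>a\<close> and
  \<open>b\<close> shortens the route. In total a constant fraction of \<open>j2 - j1\<close> is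
  gained.\<close>

lemma block_gain:
  assumes x: "joins x p" and y: "geod y k" and q: "8 * M + 2 \<le> q"
    and j: "j1 + 8 * q \<le> j2" "j2 \<le> \<delta> (fst p) (snd p)" and ab: "a < k" "b < k"
    and s: "x j1 \<in> scc (y a)" "x j2 \<in> scc (y b)"
    and M: "card (scc (y a)) \<le> M" "card (scc (y b)) \<le> M"
  shows "real (j2 - j1 + 1) / 4 \<le> (\<Sum>i\<in>{i. Suc i * q < k}. real (gain (y (i * q), y (Suc i * q)) p))"
proof -
  let ?d = "\<delta> (fst p) (snd p)"
  let ?I = "{i. Suc i * q < k}"
  have gx: "geod x ?d" using x by (simp add: joins_def)
  have V: "y a \<in> V" "y b \<in> V" using geod_in_V[OF y] ab by auto
  have Txx: "T (x j1) (x j2)" "\<delta> (x j1) (x j2) = j2 - j1" using geodD[OF gx, of j1 j2] j by auto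
  have A: "T (x j1) (y a)" "\<delta> (x j1) (y a) \<le> M" "T (y a) (x j1)" "\<delta> (y a) (x j1) \<le> M"
    using scc_diam[OF s(1) scc_refl[OF V(1)]] scc_diam[OF scc_refl[OF V(1)] s(1)] M by auto
  have Bb: "T (x j2) (y b)" "\<delta> (x j2) (y b) \<le> M" "T (y b) (x j2)" "\<delta> (y b) (x j2) \<le> M"
    using scc_diam[OF s(2) scc_refl[OF V(2)]] scc_diam[OF scc_refl[OF V(2)] s(2)] M by auto
  have Tab: "T (y a) (y b)" using T_trans[OF A(3) T_trans[OF Txx(1) Bb(1)]] .
  \<comment> \<open>Otherwise \<open>y a\<close> and \<open>y b\<close> lie in one component with at
    most \<open>M\<close> vertices, too small for a stretch of length \<open>8 * q\<close>.\<close>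
  have "a < b"
  proof (rule ccontr)
    assume "\<not> a < b"
    then have "T (y b) (y a)" using geodD[OF y, of b a] ab by simp
    then have "y b \<in> scc (y a)" using Tab by (simp add: scc_def)
    then have "x j2 \<in> scc (y a)" using s(2) scc_eq by blast
    then have "j2 - j1 < M" using scc_diam[OF s(1)] Txx(2) M(1) by fastforce
    then show False using j q by simp
  qed
  have dab: "\<delta> (y a) (y b) = b - a" using geodD[OF y, of a b] \<open>a < b\<close> ab by simp
  have ba1: "b - a \<le> 2 * M + (j2 - j1)"
    using d_tri[OF A(3) T_trans[OF Txx(1) Bb(1)]] d_tri[OF Txx(1) Bb(1)] A Bb Txx dab by linarith
  have ba2: "j2 - j1 \<le> 2 * M + (b - a)"
    using d_tri[OF A(1) T_trans[OF Tab Bb(3)]] d_tri[OF Tab Bb(3)] A Bb Txx dab by linarith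
  \<comment> \<open>The overhead is \<open>2 * M\<close> for the two changes, \<open>2 * M\<close>
    for the possibly longer stretch of \<open>y\<close>, and 1 for the edge. It is at most
    \<open>q / 2\<close> because \<open>8 * M + 2 \<le> q\<close>.\<close>
  define \<kappa> where "\<kappa> = q - 4 * M - 1"
  \<comment> \<open>The indices whose edge lies entirely between positions \<open>a\<close> and
    \<open>b\<close> of the block.\<close>
  let ?N = "{Suc (a div q) ..< b div q}"
  have qpos: "q > 0" using q by simp
  have NI: "?N \<subseteq> ?I"
  proof
    fix i assume "i \<in> ?N"
    then have "Suc i * q \<le> b div q * q" by (intro mult_le_mono1) simp
    then have "Suc i * q < k" using ab(2) div_times_less_eq_dividend[of b q] by linarith
    then show "i \<in> ?I" by simp
  qed
  have each: "\<kappa> \<le> gain (y (i * q), y (Suc i * q)) p" if i: "i \<in> ?N" for i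
  proof -
    have "Suc i * q \<le> b div q * q" using i by (intro mult_le_mono1) simp
    then have iq: "Suc i * q \<le> b" using div_times_less_eq_dividend[of b q] by linarith
    have "Suc (a div q) * q \<le> i * q" using i by (intro mult_le_mono1) simp
    moreover have "a < Suc (a div q) * q" using dividend_less_div_times[OF qpos, of a] by simp
    ultimately have aq: "a \<le> i * q" by simp
    have U: "T (y a) (y (i * q))" "\<delta> (y a) (y (i * q)) = i * q - a"
      using geodD[OF y aq] iq ab by auto
    have W: "T (y (Suc i * q)) (y b)" "\<delta> (y (Suc i * q)) (y b) = b - Suc i * q"
      using geodD[OF y iq] ab by auto
    show ?thesis
    proof (rule joins_gain[OF x, of j1 j2 _ "M + (i * q - a)" _ "(b - Suc i * q) + M"])
      show "T (x j1) (y (i * q))" using T_trans[OF A(1) U(1)] .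
      show "\<delta> (x j1) (y (i * q)) \<le> M + (i * q - a)" using d_tri[OF A(1) U(1)] A U by simp
      show "T (y (Suc i * q)) (x j2)" using T_trans[OF W(1) Bb(3)] .
      show "\<delta> (y (Suc i * q)) (x j2) \<le> b - Suc i * q + M" using d_tri[OF W(1) Bb(3)] Bb W by simp
      have "Suc i * q = i * q + q" by simp
      then show "j1 + (M + (i * q - a)) + 1 + (b - Suc i * q + M) + \<kappa> \<le> j2"
        using aq iq ba1 j q unfolding \<kappa>_def by linarith
    qed (use j in auto)
  qed
  have fI: "finite ?I" using block_index[OF qpos] by simp
  have "real (card ?N) * real \<kappa> \<le> (\<Sum>i\<in>?N. real (gain (y (i * q), y (Suc i * q)) p))"
    using sum_bounded_below[of ?N "real \<kappa>"] each by simp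
  also have "\<dots> \<le> (\<Sum>i\<in>?I. real (gain (y (i * q), y (Suc i * q)) p))"
    by (rule sum_mono2[OF fI NI]) simp
  finally have le: "real (card ?N) * real \<kappa> \<le> \<dots>" .
  have "q * (b div q) + q > b" using dividend_less_div_times[OF qpos, of b] by (simp add: mult.commute)
  moreover have "q * (a div q) \<le> a" by simp
  ultimately have "real q * real (b div q) + real q > real b" "real q * real (a div q) \<le> real a"
    by (metis of_nat_add of_nat_less_iff of_nat_mult, metis of_nat_le_iff of_nat_mult)
  moreover define c where "c = real (card ?N)"
  have "real (b div q) - real (a div q) - 1 \<le> c" unfolding c_def by simp
  then have "real q * (real (b div q) - real (a div q) - 1) \<le> real q * c"
    by (intro mult_left_mono) auto
  ultimately have 1: "real b - real a - 2 * real q \<le> real q * c"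
    by (simp add: algebra_simps)
  have 2: "real (j2 - j1) - 2 * real M \<le> real b - real a"
    using ba2 \<open>a < b\<close> by linarith
  have "c * (real q / 2) \<le> c * real \<kappa>"
    using q unfolding \<kappa>_def c_def by (intro mult_left_mono) linarith+
  then have 3: "real q * c / 2 \<le> c * real \<kappa>" by (simp add: mult.commute)
  have 4: "8 * real q \<le> real (j2 - j1)" "8 * real M + 2 \<le> real q" "0 \<le> real M"
    using j q by linarith+
  \<comment> \<open>Rounding at the two ends loses at most \<open>2 * q\<close>, the changes lose
    \<open>2 * M\<close>, and half of each skip is overhead; as \<open>8 * q \<le> L\<close>, a
    quarter of \<open>L + 1\<close> remains.\<close>
  have "(L + 1) / 4 \<le> Z" if "D - 2 * Q \<le> Y" "L - 2 * M' \<le> D" "Y / 2 \<le> Z" "8 * Q \<le> L" "8 * M' + 2 \<le> Q" "0 \<le> M'"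
    for L Z D Q Y M' :: real using that by (simp add: field_simps)
  from this[OF 1 2 3 4] have "real (j2 - j1 + 1) / 4 \<le> c * real \<kappa>" by simp
  with le show ?thesis unfolding c_def by linarith
qed

end

section \<open>Families of edges with large average gain\<close>

text \<open>\<open>X\<close> fixes a geodesic for each pair, \<open>k\<close> is the block length,
  \<open>m\<close> will bound the number of classes, and \<open>R\<close> is left free until the
  sizes of the families are balanced. By \<open>long\<close>, a gain can be compared with
  \<open>m * k\<close> in place of the distance.\<close>

locale hop_pairs = hop_metric V T \<delta>
  for V :: "'a set" and T and \<delta> +
  fixes \<Gamma> :: "('a \<times> 'a) set" and X :: "'a \<times> 'a \<Rightarrow> nat \<Rightarrow> 'a" and k m R :: nat
  assumes finite_\<Gamma>: "finite \<Gamma>"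
    and X: "p \<in> \<Gamma> \<Longrightarrow> joins (X p) p"
    and k: "k \<ge> 1" and m: "m \<ge> 1" and R: "R \<ge> 1"
    and long: "p \<in> \<Gamma> \<Longrightarrow> \<delta> (fst p) (snd p) \<le> 64 * m * k"
    and V_ne: "V \<noteq> {}"
begin

abbreviation d :: "'a \<times> 'a \<Rightarrow> nat" where "d p \<equiv> \<delta> (fst p) (snd p)"

text \<open>The first term is what edges within a part or along a block achieve, the second what
  edges between parts or towards a block achieve. The denominator absorbs all constants and powers
  of \<open>m\<close> lost in the estimates.\<close>

definition rate :: real where
  "rate = min (real R / card V) (real k ^ 3 / (real (card V) ^ 2 * R)) / (2 ^ 25 * real m ^ 4)"

text \<open>The largest subset of \<open>\<Gamma>\<close> to which \<open>cheapI\<close> applies at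
  this rate, for a family of at most \<open>B\<close> edges.\<close>

definition served :: "'i set \<Rightarrow> ('i \<Rightarrow> 'a \<times> 'a) \<Rightarrow> real \<Rightarrow> ('a \<times> 'a) set" where
  "served I e B = {p\<in>\<Gamma>. rate * B * d p \<le> (\<Sum>i\<in>I. real (gain (e i) p))}"

lemma n_pos: "real (card V) > 0"
  using V_ne finite_V by (simp add: card_gt_0_iff)

lemma rate_nonneg: "rate \<ge> 0"
  unfolding rate_def by simp

lemma cheap_served:
  assumes "finite I" "\<And>i. i \<in> I \<Longrightarrow> T (fst (e i)) (snd (e i))" "real (card I) \<le> B" "B > 0"
  shows "cheap \<Gamma> rate (served I e B)"
  by (rule cheapI[OF finite_\<Gamma> _ V_ne assms]) (auto simp: served_def)

lemma servedI:
  assumes "p \<in> \<Gamma>" "B \<ge> 0" "rate * B * (64 * m * k) \<le> c" "c \<le> (\<Sum>i\<in>I. real (gain (e i) p))"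
  shows "p \<in> served I e B"
proof -
  have "real (d p) \<le> real (64 * m * k)" using long[OF assms(1)] by (rule of_nat_mono)
  then have "rate * B * d p \<le> rate * B * (64 * m * k)"
    using assms(2) rate_nonneg by (intro mult_left_mono mult_nonneg_nonneg) auto
  then show ?thesis using assms by (simp add: served_def)
qed

lemma rate_le_R: "rate \<le> real R / card V / (2 ^ 25 * real m ^ 4)"
  unfolding rate_def by (intro divide_right_mono) auto

lemma rate_le_k: "rate \<le> real k ^ 3 / (real (card V) ^ 2 * R) / (2 ^ 25 * real m ^ 4)"
  unfolding rate_def by (intro divide_right_mono) auto

lemma power_m_mono: "i \<le> j \<Longrightarrow> real m ^ i \<le> real m ^ j"
  using m by (intro power_increasing) auto

text \<open>Call an index dense if its part is met at least \<open>h\<close> times. If the dense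
  indices make up \<open>k / (2 * m)\<close>, the at most \<open>card V * s\<close> edges within
  parts serve \<open>p\<close> by \<open>dense_gain\<close>, since \<open>h\<^sup>2\<close> is at
  least \<open>s * R\<close>; otherwise as many indices are sparse.\<close>

lemma dense_or_sparse:
  assumes p: "p \<in> \<Gamma>" and J: "J \<subseteq> {..d p}" "X p ` J \<subseteq> W" "k \<le> m * card J"
    and W: "W \<subseteq> V" and s: "s > 0" and h: "3 \<le> h" "real s * R \<le> h\<^sup>2"
  shows "p \<in> served (same_part W g) (\<lambda>e. e) (real (card V) * s) \<or>
    (\<exists>J'\<subseteq>J. k \<le> 2 * m * card J' \<and> (\<forall>j\<in>J'. real (card {j'\<in>J. g (X p j') = g (X p j)}) < h))"
proof -
  let ?den = "\<lambda>j. h \<le> real (card {j'\<in>J. g (X p j') = g (X p j)})"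
  define Jd where "Jd = {j\<in>J. ?den j}"
  have fJ: "finite J" using J(1) finite_subset by blast
  have split: "card J = card Jd + card (J - Jd)"
    using fJ card_mono[OF fJ, of Jd] by (simp add: card_Diff_subset Jd_def)
  show ?thesis
  proof (cases "k \<le> 2 * m * card Jd")
    case True
    \<comment> \<open>Density is a property of the part, so passing to the dense indices changes
      none of the counts.\<close>
    have fib: "{j'\<in>Jd. g (X p j') = g (X p j)} = {j'\<in>J. g (X p j') = g (X p j)}" if "j \<in> Jd" for j
      using that by (auto simp: Jd_def)
    have "real (card Jd) * h\<^sup>2 / 27 \<le> (\<Sum>e\<in>same_part W g. real (gain e p))"
      by (rule dense_gain[OF X[OF p] _ _ _ h(1)])
        (use J W finite_subset[OF W finite_V] fib in \<open>auto simp: Jd_def\<close>)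
    moreover have "rate * (real (card V) * s) * (64 * m * k) \<le> real (card Jd) * h\<^sup>2 / 27"
    proof -
      have "rate * (real (card V) * s) * (64 * m * k)
          \<le> real R / card V / (2 ^ 25 * real m ^ 4) * (real (card V) * s) * (64 * m * k)"
        using rate_le_R by (intro mult_right_mono) auto
      also have "\<dots> = real s * R * k * 64 / (2 ^ 25 * real m ^ 3)"
        using n_pos m by (simp add: field_simps power_def)
      also have "\<dots> \<le> real s * R * k * 64 / (2 ^ 25 * real m)"
        using power_m_mono[of 1 3] m by (intro divide_left_mono) auto
      also have "\<dots> \<le> real s * R * k / (2 * real m) / 27"
        using m by (simp add: field_simps)
      also have "\<dots> = real s * R * (real k / (2 * real m)) / 27" by simp
      also have "\<dots> \<le> h\<^sup>2 * real (card Jd) / 27"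
      proof (intro divide_right_mono mult_mono)
        have "real k \<le> real (2 * m * card Jd)" using True by (rule of_nat_mono)
        then show "real k / (2 * real m) \<le> real (card Jd)" using m by (simp add: field_simps)
      qed (use h in auto)
      finally show ?thesis by (simp add: mult.commute)
    qed
    ultimately show ?thesis by (intro disjI1 servedI[OF p]) auto
  next
    case False
    then have "k \<le> 2 * m * card (J - Jd)"
      using J(3) unfolding split by (simp add: algebra_simps)
    then show ?thesis by (intro disjI2 exI[of _ "J - Jd"]) (auto simp: Jd_def not_le)
  qed
qed

section \<open>Classes of component sizes and the families that serve them\<close>

definition cls :: "'a \<Rightarrow> nat" where
  "cls w = (if k \<le> card (scc w) then 0 else Suc (floor_log (card (scc w))))"

definition hits :: "nat \<Rightarrow> 'a \<times> 'a \<Rightarrow> nat \<Rightarrow> nat set" where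
  "hits c p a = {j\<in>{a..<a + k}. cls (X p j) = c}"

text \<open>The offset \<open>8 * k\<close> leaves room for the length of the first block, detours
  of at most \<open>4 * k\<close> in total, the edge itself, and a gain of \<open>k\<close>.\<close>

definition two_blocks :: "nat \<Rightarrow> ('a \<times> 'a) set" where
  "two_blocks c = {p\<in>\<Gamma>. \<exists>a1 a2. a1 + 8 * k \<le> a2 \<and> a2 + k \<le> d p \<and>
     k \<le> m * card (hits c p a1) \<and> k \<le> m * card (hits c p a2)}"

text \<open>The summand 3 makes the cubic counting bound applicable. As the root is at least 1, it
  costs no more than a factor 4.\<close>

lemma thr_props:
  fixes s :: nat
  assumes "s \<ge> 1"
  defines "h \<equiv> sqrt (real s * R) + 3"
  shows "3 \<le> h" "real s * R \<le> h\<^sup>2" "h\<^sup>2 \<le> 16 * real s * R"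
proof -
  have 1: "1 * 1 \<le> real s * real R" using assms(1) R by (intro mult_mono) auto
  then have q1: "1 \<le> sqrt (real s * R)" by simp
  have sq: "(sqrt (real s * R))\<^sup>2 = real s * R" by simp
  show "3 \<le> h" unfolding h_def by simp
  have "(sqrt (real s * R))\<^sup>2 \<le> h\<^sup>2" unfolding h_def by (intro power_mono) auto
  then show "real s * R \<le> h\<^sup>2" using sq by simp
  have "h\<^sup>2 \<le> (4 * sqrt (real s * R))\<^sup>2" unfolding h_def using q1 by (intro power_mono) auto
  also have "\<dots> = 16 * (real s * R)" by (simp add: power_mult_distrib)
  finally show "h\<^sup>2 \<le> 16 * real s * R" by simp
qed

lemma card_image_sparse:
  assumes "finite J'" "J' \<subseteq> J" "finite J" "\<And>j. j \<in> J' \<Longrightarrow> real (card {j'\<in>J. g j' = g j}) \<le> h"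
  shows "real (card J') \<le> h * real (card (g ` J'))"
proof (rule card_le_mult_card_image[OF assms(1)])
  fix b assume "b \<in> g ` J'"
  then obtain j where j: "j \<in> J'" "b = g j" by blast
  have "card {a\<in>J'. g a = b} \<le> card {j'\<in>J. g j' = g j}"
    using assms(2,3) j by (intro card_mono) auto
  then show "real (card {a\<in>J'. g a = b}) \<le> h" using assms(4)[OF j(1)] by linarith
qed

text \<open>One partition groups vertices around centres they reach within \<open>2 * k\<close>, the
  other around centres that reach them within \<open>2 * k\<close>. If neither partition serves
  \<open>p\<close> through edges within its parts, each block meets at least
  \<open>k / (2 * m * h)\<close> parts, and the edges from centres of the first kind to centres of
  the second serve \<open>p\<close>.\<close>

lemma big_class:
  "\<exists>G1 G2 G3. cheap \<Gamma> rate G1 \<and> cheap \<Gamma> rate G2 \<and> cheap \<Gamma> rate G3 \<and>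
     two_blocks 0 \<subseteq> G1 \<union> G2 \<union> G3 \<and> G1 \<union> G2 \<union> G3 \<subseteq> \<Gamma>"
proof -
  define W where "W = {w\<in>V. k \<le> card (scc w)}"
  have W: "W \<subseteq> V" "finite W" using finite_V by (auto simp: W_def)
  obtain co where co: "\<forall>w\<in>W. co w \<in> scc w \<and> \<delta> w (co w) \<le> 2 * k" "k * card (co ` W) \<le> card V"
    using centres[OF k] unfolding W_def by blast
  obtain ci where ci: "\<forall>w\<in>W. ci w \<in> scc w \<and> \<delta> (ci w) w \<le> 2 * k" "k * card (ci ` W) \<le> card V"
    using centres_dual[OF k] unfolding W_def by blast
  obtain gO :: "'a \<Rightarrow> 'a \<times> nat" where gO: "\<forall>w\<in>W. fst (gO w) = co w"
    "\<forall>w\<in>W. card {v\<in>W. gO v = gO w} \<le> k" "k * card (gO ` W) \<le> card W + k * card (co ` W)"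
    using refine_fibres[OF W(2) k, of co] by blast
  obtain gI :: "'a \<Rightarrow> 'a \<times> nat" where gI: "\<forall>w\<in>W. fst (gI w) = ci w"
    "\<forall>w\<in>W. card {v\<in>W. gI v = gI w} \<le> k" "k * card (gI ` W) \<le> card W + k * card (ci ` W)"
    using refine_fibres[OF W(2) k, of ci] by blast
  let ?n = "real (card V)" and ?k = "real k" and ?m = "real m"
  have cW: "card W \<le> card V" using W finite_V by (intro card_mono) auto
  have cO: "?k * real (card (gO ` W)) \<le> 2 * ?n" and cI: "?k * real (card (gI ` W)) \<le> 2 * ?n"
  proof -
    have "k * card (gO ` W) \<le> 2 * card V" "k * card (gI ` W) \<le> 2 * card V"
      using gO(3) gI(3) cW co(2) ci(2) by linarith+
    then have "real (k * card (gO ` W)) \<le> real (2 * card V)" "real (k * card (gI ` W)) \<le> real (2 * card V)"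
      by (simp_all only: of_nat_le_iff)
    then show "?k * real (card (gO ` W)) \<le> 2 * ?n" "?k * real (card (gI ` W)) \<le> 2 * ?n" by simp_all
  qed
  define h where "h = sqrt (real k * R) + 3"
  note h = thr_props[OF k, folded h_def]
  define u :: "'a \<times> nat \<Rightarrow> 'a" where "u = fst"
  \<comment> \<open>If the second centre is not reachable from the first, the loop at the first is
    used, so that every index names an admissible edge.\<close>
  define v :: "'a \<times> nat \<Rightarrow> 'a \<times> nat \<Rightarrow> 'a"
    where "v a b = (if T (fst a) (fst b) then fst b else fst a)" for a b
  define I where "I = gO ` W \<times> gI ` W"
  define e where "e = (\<lambda>(a, b). (u a, v a b))"
  \<comment> \<open>Each partition has at most \<open>2 * n / k\<close> parts: at most
    \<open>n / k\<close> from cutting into pieces and \<open>n / k\<close> from the number of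
    centres.\<close>
  define B where "B = 4 * ?n\<^sup>2 / ?k\<^sup>2"
  let ?GO = "served (same_part W gO) (\<lambda>e. e) (?n * k)"
  let ?GI = "served (same_part W gI) (\<lambda>e. e) (?n * k)"
  have k0: "?k > 0" and m0: "?m > 0" using k m by auto
  have part: "cheap \<Gamma> rate (served (same_part W g) (\<lambda>e. e) (?n * k))"
    if g: "\<forall>w\<in>W. card {v\<in>W. g v = g w} \<le> k" for g :: "'a \<Rightarrow> 'a \<times> nat"
  proof (rule cheap_served)
    have "card (same_part W g) \<le> card W * k" using g by (intro card_same_part[OF W(2)]) auto
    also have "\<dots> \<le> card V * k" using cW by simp
    finally show "real (card (same_part W g)) \<le> ?n * k"
      unfolding of_nat_mult[symmetric] by (rule of_nat_mono)
  qed (use W n_pos k0 in \<open>auto simp: same_part_def\<close>)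
  have cross: "cheap \<Gamma> rate (served I e B)"
  proof (rule cheap_served)
    show "finite I" using W by (simp add: I_def)
    show "T (fst (e i)) (snd (e i))" if i: "i \<in> I" for i
    proof -
      obtain w b where w: "w \<in> W" "i = (gO w, b)" using i by (auto simp: I_def)
      have "co w \<in> V" using co(1) w scc_subset by blast
      then have "T (fst (gO w)) (fst (gO w))" using gO(1) w by (simp add: T_refl)
      then show ?thesis using w by (simp add: e_def u_def v_def)
    qed
    have "?k * real (card (gO ` W)) * (?k * real (card (gI ` W))) \<le> 2 * ?n * (2 * ?n)"
      by (rule mult_mono[OF cO cI]) auto
    then show "real (card I) \<le> B"
      using k0 by (simp add: I_def B_def card_cartesian_product field_simps power2_eq_square)
    show "B > 0" using n_pos k0 by (simp add: B_def)
  qed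
  have "p \<in> ?GO \<union> ?GI \<union> served I e B" if p2: "p \<in> two_blocks 0" for p
  proof (rule ccontr)
    assume np: "p \<notin> ?GO \<union> ?GI \<union> served I e B"
    obtain a1 a2 where p: "p \<in> \<Gamma>" and a: "a1 + 8 * k \<le> a2" "a2 + k \<le> d p"
      "k \<le> m * card (hits 0 p a1)" "k \<le> m * card (hits 0 p a2)"
      using p2 unfolding two_blocks_def by blast
    have gx: "geod (X p) (d p)" using X[OF p] by (simp add: joins_def)
    have hit: "hits 0 p b \<subseteq> {..d p}" "X p ` hits 0 p b \<subseteq> W" if "b + k \<le> d p" for b
    proof -
      show 1: "hits 0 p b \<subseteq> {..d p}" using that by (auto simp: hits_def)
      have "X p j \<in> W" if "j \<in> hits 0 p b" for j
        using that geod_in_V[OF gx, of j] 1 by (auto simp: hits_def W_def cls_def split: if_splits)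
      then show "X p ` hits 0 p b \<subseteq> W" by blast
    qed
    have a1k: "a1 + k \<le> d p" using a by simp
    obtain J1 where J1: "J1 \<subseteq> hits 0 p a1" "k \<le> 2 * m * card J1"
      "\<forall>j\<in>J1. real (card {j'\<in>hits 0 p a1. gO (X p j') = gO (X p j)}) < h"
      using dense_or_sparse[OF p hit(1)[OF a1k] hit(2)[OF a1k] a(3) W(1) _ h(1,2), of gO] np k by auto
    obtain J2 where J2: "J2 \<subseteq> hits 0 p a2" "k \<le> 2 * m * card J2"
      "\<forall>j\<in>J2. real (card {j'\<in>hits 0 p a2. gI (X p j') = gI (X p j)}) < h"
      using dense_or_sparse[OF p hit(1)[OF a(2)] hit(2)[OF a(2)] a(4) W(1) _ h(1,2), of gI] np k by auto
    have fh: "finite (hits 0 p b)" for b by (simp add: hits_def)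
    have fJ: "finite J1" "finite J2" using J1(1) J2(1) fh finite_subset by blast+
    define t1 where "t1 = real (card ((\<lambda>j. gO (X p j)) ` J1))"
    define t2 where "t2 = real (card ((\<lambda>j. gI (X p j)) ` J2))"
    have "real (card J1) \<le> h * t1" unfolding t1_def
      using J1(3) by (intro card_image_sparse[OF fJ(1) J1(1) fh]) (auto intro: less_imp_le)
    moreover have "?k \<le> 2 * ?m * real (card J1)"
      using of_nat_mono[OF J1(2), where 'a = real] by simp
    moreover from calculation(1) have "2 * ?m * real (card J1) \<le> 2 * ?m * (h * t1)"
      using m0 by (intro mult_left_mono) auto
    ultimately have "?k \<le> 2 * ?m * (h * t1)" by linarith
    then have t1: "?k / (2 * ?m * h) \<le> t1" using m0 h(1) by (simp add: field_simps)
    have "real (card J2) \<le> h * t2" unfolding t2_def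
      using J2(3) by (intro card_image_sparse[OF fJ(2) J2(1) fh]) (auto intro: less_imp_le)
    moreover have "?k \<le> 2 * ?m * real (card J2)"
      using of_nat_mono[OF J2(2), where 'a = real] by simp
    moreover from calculation(1) have "2 * ?m * real (card J2) \<le> 2 * ?m * (h * t2)"
      using m0 by (intro mult_left_mono) auto
    ultimately have "?k \<le> 2 * ?m * (h * t2)" by linarith
    then have t2: "?k / (2 * ?m * h) \<le> t2" using m0 h(1) by (simp add: field_simps)
    have xW: "X p j \<in> W" if "j \<in> J1 \<union> J2" for j
      using that J1(1) J2(1) hit(2)[OF a1k] hit(2)[OF a(2)] by blast
    have "t1 * t2 * real k \<le> (\<Sum>(a, b)\<in>I. real (gain (u a, v a b) p))"
      unfolding t1_def t2_def I_def
    proof (rule cross_gain[OF X[OF p], where \<alpha> = "2 * k" and \<gamma> = "2 * k"])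
      show "J1 \<subseteq> {..d p}" "J2 \<subseteq> {..d p}" using J1(1) J2(1) hit(1)[OF a1k] hit(1)[OF a(2)] by blast+
      show "(\<lambda>j. gO (X p j)) ` J1 \<subseteq> gO ` W" "(\<lambda>j. gI (X p j)) ` J2 \<subseteq> gI ` W" using xW by blast+
      fix i assume i: "i \<in> J1"
      have "co (X p i) \<in> scc (X p i)" "\<delta> (X p i) (co (X p i)) \<le> 2 * k" using co(1) xW i by auto
      then show U: "T (X p i) (u (gO (X p i))) \<and> \<delta> (X p i) (u (gO (X p i))) \<le> 2 * k"
        using gO(1) xW i by (auto simp: u_def scc_def)
      fix j assume j: "j \<in> J2"
      have ij: "a1 \<le> i" "i < a1 + k" "a2 \<le> j" "j < a2 + k" using i j J1(1) J2(1) by (auto simp: hits_def)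
      then show "i + 2 * k + 1 + 2 * k + k \<le> j" using a by linarith
      have C: "ci (X p j) \<in> scc (X p j)" "\<delta> (ci (X p j)) (X p j) \<le> 2 * k" using ci(1) xW j by auto
      have "T (X p i) (X p j)" using geodD[OF gx, of i j] ij a by auto
      moreover have "T (co (X p i)) (X p i)" using co(1) xW i by (auto simp: scc_def)
      moreover have "T (X p j) (ci (X p j))" "T (ci (X p j)) (X p j)" using C by (auto simp: scc_def)
      ultimately have "T (co (X p i)) (ci (X p j))" "T (ci (X p j)) (X p j)"
        using T_trans[of "co (X p i)" "X p i" "X p j"] T_trans[of "co (X p i)" "X p j" "ci (X p j)"] by blast+
      then show "T (v (gO (X p i)) (gI (X p j))) (X p j) \<and> \<delta> (v (gO (X p i)) (gI (X p j))) (X p j) \<le> 2 * k"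
        using C gO(1) gI(1) xW i j by (simp add: v_def)
    qed (use W in auto)
    moreover have "rate * B * (64 * m * k) \<le> t1 * t2 * real k"
    proof -
      have "rate * B * (64 * m * k)
          \<le> ?k ^ 3 / (?n ^ 2 * R) / (2 ^ 25 * ?m ^ 4) * B * (64 * m * k)"
        using rate_le_k n_pos by (intro mult_right_mono) (auto simp: B_def)
      also have "\<dots> = 256 * ?k\<^sup>2 / (R * 2 ^ 25 * ?m ^ 3)"
        using n_pos m0 k0 R by (simp add: B_def field_simps power_def)
      also have "\<dots> \<le> 256 * ?k\<^sup>2 / (R * 2 ^ 25 * ?m\<^sup>2)"
        using power_m_mono[of 2 3] m0 R by (intro divide_left_mono mult_left_mono) auto
      also have "\<dots> \<le> ?k\<^sup>2 / (64 * ?m\<^sup>2 * R)"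
        using m0 R by (simp add: field_simps)
      also have "\<dots> = ?k ^ 3 / (4 * ?m\<^sup>2 * (16 * ?k * R))"
        using k0 m0 R by (simp add: field_simps power_def)
      also have "\<dots> \<le> ?k ^ 3 / (4 * ?m\<^sup>2 * h\<^sup>2)"
        using h m0 k0 R by (intro divide_left_mono mult_left_mono mult_pos_pos) auto
      also have "\<dots> = (?k / (2 * ?m * h)) * (?k / (2 * ?m * h)) * ?k"
        by (simp add: power_def numeral_eq_Suc mult_ac)
      also have "\<dots> \<le> t1 * t2 * ?k"
        using t1 t2 m0 k0 h(1) by (intro mult_right_mono mult_mono) (auto simp: t1_def)
      finally show ?thesis .
    qed
    ultimately have "p \<in> served I e B"
      by (intro servedI[OF p, where c = "t1 * t2 * real k"]) (auto simp: B_def e_def case_prod_beta)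
    then show False using np by blast
  qed
  then show ?thesis using part[OF gO(2)] part[OF gI(2)] cross
    by (intro exI[of _ ?GO] exI[of _ ?GI] exI[of _ "served I e B"]) (auto simp: served_def)
qed


text \<open>The families are the pairs within a component, the skip edges along greedily chosen
  blocks, and the edges from a component to a chosen block. If the first fails, at least
  \<open>k / (4 * m)\<close> indices of the second block lie in covered components. Half of these
  accompany a chosen block over a long stretch, or half of them are spread over many chosen
  blocks.\<close>

lemma small_class:
  "\<exists>G1 G2 G3. cheap \<Gamma> rate G1 \<and> cheap \<Gamma> rate G2 \<and> cheap \<Gamma> rate G3 \<and>
     two_blocks (Suc i) \<subseteq> G1 \<union> G2 \<union> G3 \<and> G1 \<union> G2 \<union> G3 \<subseteq> \<Gamma>"
proof -
  define \<mu> :: nat where "\<mu> = 2 ^ i"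
  have \<mu>: "\<mu> \<ge> 1" "2 * \<mu> \<ge> 1" by (auto simp: \<mu>_def)
  define W where "W = {w\<in>V. cls w = Suc i}"
  have W: "W \<subseteq> V" "finite W" using finite_V by (auto simp: W_def)
  have Wsz: "\<mu> \<le> card (scc w)" "card (scc w) < 2 * \<mu>" "card (scc w) < k" if "w \<in> W" for w
  proof -
    have w: "w \<in> V" "cls w = Suc i" using that by (auto simp: W_def)
    then have f: "card (scc w) < k" "floor_log (card (scc w)) = i"
      by (auto simp: cls_def split: if_splits)
    have "card (scc w) > 0" using scc_refl[OF w(1)] finite_scc by (auto simp: card_gt_0_iff)
    then show "\<mu> \<le> card (scc w)" "card (scc w) < 2 * \<mu>" "card (scc w) < k"
      using floor_log_exp2_le[of "card (scc w)"] floor_log_exp2_gt[of "card (scc w)"] f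
      by (auto simp: \<mu>_def)
  qed
  have cls_scc: "cls v = cls w" if "v \<in> scc w" for v w
    using scc_eq[OF that] by (simp add: cls_def)
  have sccW: "scc w \<subseteq> W" if "w \<in> W" for w
    using that scc_subset cls_scc by (auto simp: W_def)
  let ?n = "real (card V)" and ?k = "real k" and ?m = "real m" and ?\<mu> = "real \<mu>" and ?R = "real R"
  have k0: "?k > 0" "?m > 0" "?\<mu> \<ge> 1" "?R \<ge> 1" using k m \<mu> R by auto
  define h where "h = sqrt (real (2 * \<mu>) * R) + 3"
  note h = thr_props[OF \<mu>(2), folded h_def]
  \<comment> \<open>Bounds how many indices of a block lie in one sparse component: the component
    has fewer than \<open>2 * \<mu>\<close> vertices, and it is met fewer than \<open>h\<close>
    times.\<close>
  define \<eta> where "\<eta> = min (2 * ?\<mu>) h"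
  \<comment> \<open>The skip length: \<open>16 * \<mu> + 2\<close> meets the requirement of
    \<open>block_gain\<close> for \<open>M = 2 * \<mu>\<close>, and the summand \<open>R\<close>
    keeps the number of skip edges small.\<close>
  define q where "q = 16 * \<mu> + 2 + R"
  have \<eta>: "\<eta> > 0" "\<eta> \<le> 2 * ?\<mu>" "\<eta> \<le> h" using k0 h(1) by (auto simp: \<eta>_def)
  have qpos: "q > 0" "real q > 0" by (auto simp: q_def)
  \<comment> \<open>The two bounds on \<open>\<eta>\<close> are used according to whether
    \<open>R\<close> or \<open>\<mu>\<close> dominates \<open>q\<close>. The cases need only 44 and
    640; 910 still satisfies \<open>256 * 910 / 2 ^ 25 \<le> 1 / 144\<close>, as used at the
    end.\<close>
  have \<eta>q: "\<eta>\<^sup>2 * q \<le> 910 * ?\<mu>\<^sup>2 * ?R"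
  proof (cases "2 * \<mu> \<le> R")
    case True
    have "\<eta>\<^sup>2 \<le> (2 * ?\<mu>)\<^sup>2" using \<eta> by (intro power_mono) auto
    moreover have "real q \<le> 11 * ?R" using True R by (simp add: q_def)
    ultimately have "\<eta>\<^sup>2 * q \<le> (2 * ?\<mu>)\<^sup>2 * (11 * ?R)" by (intro mult_mono) auto
    also have "\<dots> \<le> 910 * ?\<mu>\<^sup>2 * ?R" by (simp add: power2_eq_square)
    finally show ?thesis .
  next
    case False
    have "\<eta>\<^sup>2 \<le> h\<^sup>2" using \<eta> by (intro power_mono) auto
    then have "\<eta>\<^sup>2 \<le> 32 * ?\<mu> * ?R" using h(3) by simp
    moreover have "real q \<le> 20 * ?\<mu>" using False \<mu> by (simp add: q_def)
    ultimately have "\<eta>\<^sup>2 * q \<le> (32 * ?\<mu> * ?R) * (20 * ?\<mu>)" by (intro mult_mono) auto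
    also have "\<dots> \<le> 910 * ?\<mu>\<^sup>2 * ?R" by (simp add: power2_eq_square)
    finally show ?thesis .
  qed

  define U where "U = scc ` W"
  have fU: "finite U" using W by (simp add: U_def)
  have cU: "?\<mu> * real (card U) \<le> ?n"
  proof -
    have "?\<mu> * real (card (scc ` W)) \<le> real (card W)"
    proof (rule mult_card_image_le_card[OF W(2)])
      fix b assume "b \<in> scc ` W"
      then obtain w where w: "w \<in> W" "b = scc w" by blast
      have "scc w \<subseteq> {a\<in>W. scc a = b}" using sccW[OF w(1)] scc_eq w(2) by blast
      then have "card (scc w) \<le> card {a\<in>W. scc a = b}" using W by (intro card_mono) auto
      then show "?\<mu> \<le> real (card {a\<in>W. scc a = b})" using Wsz(1)[OF w(1)] by linarith
    qed
    also have "\<dots> \<le> ?n" using card_mono[OF finite_V W(1)] by simp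
    finally show ?thesis by (simp add: U_def)
  qed
  define rep where "rep S = (SOME v. v \<in> S)" for S :: "'a set"
  have rep: "rep (scc w) \<in> scc w" if "w \<in> V" for w
    unfolding rep_def using scc_refl[OF that] by (rule someI)

  define F where "F = {y. \<exists>p a. p \<in> \<Gamma> \<and> a + k \<le> d p \<and> y = (\<lambda>j. X p (a + j))}"
  have FG: "geod y k" if y: "y \<in> F" for y
  proof -
    obtain p a where pa: "p \<in> \<Gamma>" "a + k \<le> d p" "y = (\<lambda>j. X p (a + j))"
      using y unfolding F_def by blast
    have "geod (X p) (d p)" using X[OF pa(1)] by (simp add: joins_def)
    from geod_shift[OF this pa(2)] show ?thesis by (simp add: pa(3))
  qed
  \<comment> \<open>Half of the \<open>k / (2 * m * \<eta>)\<close> components that the sparse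
    indices of a block must meet, so uncovered components account for at most
    \<open>k / (4 * m)\<close> of these indices.\<close>
  define \<nu> where "\<nu> = ?k / (4 * ?m * \<eta>)"
  have \<nu>: "\<nu> > 0" using k0 \<eta> by (simp add: \<nu>_def)
  define rel where "rel y = (\<lambda>j. scc (y j)) ` {..<k}" for y :: "nat \<Rightarrow> 'a"
  obtain C f where Cf: "C \<subseteq> U" "\<forall>c\<in>C. f c \<in> F \<and> c \<in> rel (f c)" "\<nu> * card (f ` C) \<le> card C"
    "\<forall>y\<in>F. card (rel y \<inter> U - C) \<le> \<nu>"
    using greedy_cover[OF fU, of \<nu> F rel] \<nu> by auto
  define \<P> where "\<P> = f ` C"
  have fC: "finite C" using Cf(1) fU finite_subset by blast
  have cP: "?\<mu> * \<nu> * real (card \<P>) \<le> ?n"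
  proof -
    have "\<nu> * real (card \<P>) \<le> real (card U)"
      using Cf(3) card_mono[OF fU Cf(1)] unfolding \<P>_def by linarith
    then have "?\<mu> * (\<nu> * real (card \<P>)) \<le> ?\<mu> * real (card U)" by (intro mult_left_mono) auto
    then show ?thesis using cU by (simp add: mult.assoc)
  qed
  have PF: "y \<in> F" if "y \<in> \<P>" for y using that Cf(2) by (auto simp: \<P>_def)

  let ?GD = "served (same_part W scc) (\<lambda>e. e) (?n * real (2 * \<mu>))"
  have GD: "cheap \<Gamma> rate ?GD"
  proof (rule cheap_served)
    have "card (same_part W scc) \<le> card W * (2 * \<mu>)"
    proof (rule card_same_part[OF W(2)])
      fix w assume w: "w \<in> W"
      have "{v\<in>W. scc v = scc w} \<subseteq> scc w" using scc_refl W(1) by blast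
      then have "card {v\<in>W. scc v = scc w} \<le> card (scc w)" by (rule card_mono[OF finite_scc])
      then show "card {v\<in>W. scc v = scc w} \<le> 2 * \<mu>" using Wsz(2)[OF w] by linarith
    qed
    also have "\<dots> \<le> card V * (2 * \<mu>)" using card_mono[OF finite_V W(1)] by simp
    finally show "real (card (same_part W scc)) \<le> ?n * real (2 * \<mu>)"
      unfolding of_nat_mult[symmetric] by (rule of_nat_mono)
  qed (use W n_pos k0 in \<open>auto simp: same_part_def\<close>)

  define IB where "IB = \<P> \<times> {j. Suc j * q < k}"
  define eB where "eB = (\<lambda>(y :: nat \<Rightarrow> 'a, j). (y (j * q), y (Suc j * q)))"
  define BB where "BB = ?n / (?\<mu> * \<nu>) * (?k / q)"
  have fP: "finite \<P>" using fC by (simp add: \<P>_def)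
  have BB: "BB > 0" using n_pos k0 \<nu> qpos by (simp add: BB_def)
  have GB: "cheap \<Gamma> rate (served IB eB BB)"
  proof (rule cheap_served)
    show "finite IB" using fP block_index[OF qpos(1), of k] by (simp add: IB_def)
    show "T (fst (eB e)) (snd (eB e))" if eI: "e \<in> IB" for e
    proof -
      obtain y j where e: "e = (y, j)" "y \<in> \<P>" "Suc j * q < k" using eI by (auto simp: IB_def)
      have "j * q \<le> Suc j * q" by simp
      then show ?thesis using geodD[OF FG[OF PF[OF e(2)]]] e(3) by (simp add: e(1) eB_def del: mult_Suc)
    qed
    have "real (card {j. Suc j * q < k} * q) \<le> real k"
      using block_index[OF qpos(1), of k] by (simp only: of_nat_le_iff)
    then have "real (card {j. Suc j * q < k}) \<le> ?k / q"
      using qpos by (simp add: field_simps)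
    moreover have "real (card \<P>) \<le> ?n / (?\<mu> * \<nu>)" using cP \<nu> k0 by (simp add: field_simps)
    ultimately show "real (card IB) \<le> BB"
      unfolding IB_def BB_def card_cartesian_product of_nat_mult
      using n_pos \<nu> by (intro mult_mono) auto
  qed (rule BB)

  \<comment> \<open>The head is the first vertex of the block reachable from the component, hence a
    function of the component and the block alone, independent of the pair. The default is again a
    loop.\<close>
  define v where "v S y = (if \<exists>a<k. T (rep S) (y a) then y (LEAST a. T (rep S) (y a)) else rep S)"
    for S and y :: "nat \<Rightarrow> 'a"
  define IC where "IC = U \<times> \<P>"
  define eC where "eC = (\<lambda>(S, y). (rep S, v S y))"
  define BC where "BC = (?n / ?\<mu>) * (?n / (?\<mu> * \<nu>))"
  have BC: "BC > 0" using n_pos k0 \<nu> by (simp add: BC_def)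
  have vT: "T (rep S) (v S y)" if S: "S \<in> U" for S y
  proof (cases "\<exists>a<k. T (rep S) (y a)")
    case True
    then have "T (rep S) (y (LEAST a. T (rep S) (y a)))" by (auto intro: LeastI)
    then show ?thesis using True by (simp add: v_def)
  next
    case False
    obtain w where "w \<in> W" "S = scc w" using S by (auto simp: U_def)
    then have "rep S \<in> V" using rep[of w] W scc_subset by blast
    moreover have "v S y = rep S" unfolding v_def using False by (rule if_not_P)
    ultimately show ?thesis using T_refl by simp
  qed
  have GC: "cheap \<Gamma> rate (served IC eC BC)"
  proof (rule cheap_served)
    show "finite IC" using fU fP by (simp add: IC_def)
    show "T (fst (eC e)) (snd (eC e))" if "e \<in> IC" for e
      using that vT by (auto simp: IC_def eC_def)
    have "real (card \<P>) \<le> ?n / (?\<mu> * \<nu>)" using cP \<nu> k0 by (simp add: field_simps)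
    moreover have "real (card U) \<le> ?n / ?\<mu>" using cU k0 by (simp add: field_simps)
    ultimately show "real (card IC) \<le> BC"
      unfolding IC_def BC_def card_cartesian_product of_nat_mult
      by (intro mult_mono) auto
  qed (rule BC)

  have "p \<in> ?GD \<union> served IB eB BB \<union> served IC eC BC" if p2: "p \<in> two_blocks (Suc i)" for p
  proof (rule ccontr)
    assume np: "p \<notin> ?GD \<union> served IB eB BB \<union> served IC eC BC"
    obtain a1 a2 where p: "p \<in> \<Gamma>" and a: "a1 + 8 * k \<le> a2" "a2 + k \<le> d p"
      "k \<le> m * card (hits (Suc i) p a1)" "k \<le> m * card (hits (Suc i) p a2)"
      using p2 unfolding two_blocks_def by blast
    let ?x = "X p"
    have gx: "geod ?x (d p)" using X[OF p] by (simp add: joins_def)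
    have hit: "hits (Suc i) p b \<subseteq> {..d p}" "?x ` hits (Suc i) p b \<subseteq> W" if "b + k \<le> d p" for b
    proof -
      show 1: "hits (Suc i) p b \<subseteq> {..d p}" using that by (auto simp: hits_def)
      have "?x j \<in> W" if "j \<in> hits (Suc i) p b" for j
        using that geod_in_V[OF gx, of j] 1 by (auto simp: hits_def W_def)
      then show "?x ` hits (Suc i) p b \<subseteq> W" by blast
    qed
    have a1k: "a1 + k \<le> d p" using a by simp
    have s0: "2 * \<mu> > 0" using \<mu> by simp
    obtain J1 where J1: "J1 \<subseteq> hits (Suc i) p a1" "k \<le> 2 * m * card J1"
      "\<forall>j\<in>J1. real (card {j'\<in>hits (Suc i) p a1. scc (?x j') = scc (?x j)}) < h"
      using dense_or_sparse[OF p hit(1)[OF a1k] hit(2)[OF a1k] a(3) W(1) s0 h(1,2), of scc] np by auto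
    obtain J2 where J2: "J2 \<subseteq> hits (Suc i) p a2" "k \<le> 2 * m * card J2"
      "\<forall>j\<in>J2. real (card {j'\<in>hits (Suc i) p a2. scc (?x j') = scc (?x j)}) < h"
      using dense_or_sparse[OF p hit(1)[OF a(2)] hit(2)[OF a(2)] a(4) W(1) s0 h(1,2), of scc] np by auto
    have fh: "finite (hits (Suc i) p b)" for b by (simp add: hits_def)
    have fJ: "finite J1" "finite J2" using J1(1) J2(1) fh finite_subset by blast+
    have xW: "?x j \<in> W" if "j \<in> J1 \<union> J2" for j
      using that J1(1) J2(1) hit(2)[OF a1k] hit(2)[OF a(2)] by blast
    have few: "real (card {j'\<in>hits (Suc i) p b. scc (?x j') = scc (?x j)}) \<le> \<eta>"
      if b: "b + k \<le> d p" and j: "?x j \<in> W"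
        "real (card {j'\<in>hits (Suc i) p b. scc (?x j') = scc (?x j)}) < h" for b j
    proof -
      let ?A = "{j'\<in>hits (Suc i) p b. scc (?x j') = scc (?x j)}"
      have A: "?A \<subseteq> {..d p}" using hit(1)[OF b] by blast
      have "?x ` ?A \<subseteq> scc (?x j)"
      proof (rule image_subsetI)
        fix j' assume j': "j' \<in> ?A"
        then have "?x j' \<in> W" using hit(2)[OF b] by blast
        then have "?x j' \<in> V" using W(1) by blast
        then show "?x j' \<in> scc (?x j)" using scc_refl[of "?x j'"] j' by simp
      qed
      then have "card (?x ` ?A) \<le> card (scc (?x j))" by (rule card_mono[OF finite_scc])
      then have "card ?A \<le> card (scc (?x j))" using card_geod_image[OF gx A] by simp
      then have "real (card ?A) \<le> 2 * ?\<mu>" using Wsz(2)[OF j(1)] by linarith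
      then show ?thesis using j(2) by (simp add: \<eta>_def)
    qed
    have sparse: "real (card J) \<le> \<eta> * real (card ((\<lambda>j. scc (?x j)) ` J))"
      if "J \<subseteq> J1 \<or> J \<subseteq> J2" for J
    proof -
      have fin: "finite J" using that fJ finite_subset by blast
      from that show ?thesis
      proof
        assume s: "J \<subseteq> J1"
        show ?thesis
          by (rule card_image_sparse[OF fin _ fh[of a1]]) (use s J1 few[OF a1k] xW in auto)
      next
        assume s: "J \<subseteq> J2"
        show ?thesis
          by (rule card_image_sparse[OF fin _ fh[of a2]]) (use s J2 few[OF a(2)] xW in auto)
      qed
    qed
    define t1 where "t1 = real (card ((\<lambda>j. scc (?x j)) ` J1))"
    have big: "?k \<le> 2 * ?m * real (card J1)" "?k \<le> 2 * ?m * real (card J2)"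
      using of_nat_mono[OF J1(2), where 'a = real] of_nat_mono[OF J2(2), where 'a = real] by simp_all
    have "2 * ?m * real (card J1) \<le> 2 * ?m * (\<eta> * t1)"
      using sparse[of J1] k0 unfolding t1_def by (intro mult_left_mono) auto
    then have "?k \<le> 2 * ?m * (\<eta> * t1)" using big(1) by linarith
    then have t1: "?k / (2 * ?m * \<eta>) \<le> t1" using k0 \<eta> by (simp add: field_simps)

    define y2 where "y2 = (\<lambda>j. ?x (a2 + j))"
    have y2: "y2 \<in> F" unfolding F_def y2_def using p a(2) by blast
    define Jc where "Jc = {j\<in>J2. scc (?x j) \<in> C}"
    have J2r: "a2 \<le> j" "j < a2 + k" if "j \<in> J2" for j using that J2(1) by (auto simp: hits_def)
    \<comment> \<open>The second block of \<open>p\<close> is itself a candidate of the greedy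
      cover, so it meets at most \<open>\<nu>\<close> uncovered components.\<close>
    have "(\<lambda>j. scc (?x j)) ` (J2 - Jc) \<subseteq> rel y2 \<inter> U - C"
    proof (rule image_subsetI)
      fix j assume j: "j \<in> J2 - Jc"
      have "scc (?x j) = scc (y2 (j - a2))" "j - a2 < k" using J2r[of j] j by (auto simp: y2_def)
      then have "scc (?x j) \<in> rel y2" by (auto simp: rel_def)
      then show "scc (?x j) \<in> rel y2 \<inter> U - C" using j xW by (auto simp: Jc_def U_def)
    qed
    then have "card ((\<lambda>j. scc (?x j)) ` (J2 - Jc)) \<le> card (rel y2 \<inter> U - C)"
      using fU by (intro card_mono) auto
    then have "real (card ((\<lambda>j. scc (?x j)) ` (J2 - Jc))) \<le> \<nu>" using Cf(4) y2 by force
    then have "\<eta> * real (card ((\<lambda>j. scc (?x j)) ` (J2 - Jc))) \<le> \<eta> * \<nu>"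
      using \<eta> by (intro mult_left_mono) auto
    then have "real (card (J2 - Jc)) \<le> \<eta> * \<nu>" using sparse[of "J2 - Jc"] by auto
    also have "\<eta> * \<nu> = ?k / (4 * ?m)" using \<eta> k0 by (simp add: \<nu>_def)
    finally have un: "real (card (J2 - Jc)) \<le> ?k / (4 * ?m)" .
    have "card J2 = card Jc + card (J2 - Jc)"
      using fJ card_mono[OF fJ(2), of Jc] by (simp add: card_Diff_subset Jc_def)
    moreover have "?k / (2 * ?m) \<le> real (card J2)" using big(2) k0 by (simp add: field_simps)
    moreover have "?k / (2 * ?m) = ?k / (4 * ?m) + ?k / (4 * ?m)" by simp
    ultimately have Jc: "?k / (4 * ?m) \<le> real (card Jc)" using un by linarith

    define asg where "asg j = f (scc (?x j))" for j
    have asg: "asg j \<in> \<P>" "\<exists>b<k. scc (asg j b) = scc (?x j)" if "j \<in> Jc" for j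
    proof -
      have "scc (?x j) \<in> C" using that by (simp add: Jc_def)
      then have "asg j \<in> \<P>" and "scc (?x j) \<in> rel (asg j)"
        using Cf(2) by (auto simp: asg_def \<P>_def)
      then show "asg j \<in> \<P>" "\<exists>b<k. scc (asg j b) = scc (?x j)"
        unfolding rel_def by (auto simp: eq_commute)
    qed
    have in_scc: "?x j \<in> scc (asg j b) \<and> asg j b \<in> scc (?x j)"
      if "j \<in> Jc" "b < k" "scc (asg j b) = scc (?x j)" for j b
    proof -
      have "?x j \<in> V" using xW[of j] that(1) W(1) by (auto simp: Jc_def)
      moreover have "asg j b \<in> V"
        using geod_in_V[OF FG[OF PF[OF asg(1)[OF that(1)]]], of b] that(2) by simp
      ultimately show ?thesis using scc_refl[of "?x j"] scc_refl[of "asg j b"] that(3) by auto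
    qed
    let ?fib = "\<lambda>y. {j\<in>Jc. asg j = y}"
    have fJc: "finite Jc" using fJ by (simp add: Jc_def)
    \<comment> \<open>A chosen block is long for \<open>p\<close> if the indices assigned to it
      spread over at least \<open>8 * q\<close>, the stretch that \<open>block_gain\<close>
      requires.\<close>
    define lng where "lng y \<longleftrightarrow> (\<exists>j1\<in>?fib y. \<exists>j2\<in>?fib y. j1 + 8 * q \<le> j2)" for y
    define JL where "JL = {j\<in>Jc. lng (asg j)}"
    define JS where "JS = {j\<in>Jc. \<not> lng (asg j)}"
    have cLS: "card Jc = card JL + card JS"
    proof -
      have "JL \<union> JS = Jc" "JL \<inter> JS = {}" by (auto simp: JL_def JS_def)
      then show ?thesis using card_Un_disjoint[of JL JS] fJc by (auto simp: JL_def JS_def)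
    qed
    \<comment> \<open>The number of skip edges enters through \<open>R / q \<le> 1\<close> and
      \<open>\<eta> / \<mu> \<le> 2\<close>.\<close>
    have dB: "rate * BB * (64 * m * k) \<le> ?k / (32 * ?m)"
    proof -
      have "rate * BB * (64 * m * k) \<le> ?R / ?n / (2 ^ 25 * ?m ^ 4) * BB * (64 * m * k)"
        using rate_le_R BB by (intro mult_right_mono) auto
      also have "\<dots> = 256 * (?R / q) * (\<eta> / ?\<mu>) * ?k / (2 ^ 25 * ?m\<^sup>2)"
        using n_pos k0 \<eta> qpos by (simp add: BB_def \<nu>_def field_simps power_def numeral_eq_Suc)
      also have "\<dots> \<le> 256 * 1 * 2 * ?k / (2 ^ 25 * ?m\<^sup>2)"
        using k0 \<eta> qpos by (intro divide_right_mono mult_right_mono mult_mono) (auto simp: q_def field_simps)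
      also have "\<dots> \<le> 256 * 1 * 2 * ?k / (2 ^ 25 * ?m)"
        using power_m_mono[of 1 2] k0 by (intro divide_left_mono) auto
      also have "\<dots> \<le> ?k / (32 * ?m)" using k0 by (simp add: field_simps)
      finally show ?thesis .
    qed
    have JLsmall: "real (card JL) < ?k / (8 * ?m)"
    proof (rule ccontr)
      assume "\<not> ?thesis"
      then have L: "?k / (8 * ?m) \<le> real (card JL)" by simp
      have fJL: "finite JL" using fJc by (simp add: JL_def)
      have each: "real (card {j\<in>JL. asg j = y}) / 4
          \<le> (\<Sum>j\<in>{j. Suc j * q < k}. real (gain (eB (y, j)) p))" if y: "y \<in> asg ` JL" for y
      proof -
        let ?A = "{j\<in>JL. asg j = y}"
        have A: "?A = ?fib y" "lng y" using y by (auto simp: JL_def)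
        have fA: "finite ?A" using fJL by simp
        obtain l1 l2 where l: "l1 \<in> ?A" "l2 \<in> ?A" "l1 + 8 * q \<le> l2"
          using A(2) unfolding lng_def A(1) by blast
        \<comment> \<open>Between the extreme assigned indices there is room for all of them, so the
          gain on this stretch pays for the whole fibre.\<close>
        define j1 j2 where "j1 = Min ?A" and "j2 = Max ?A"
        have jA: "j1 \<in> ?A" "j2 \<in> ?A" unfolding j1_def j2_def using fA l(1) by (intro Min_in Max_in; blast)+
        have "j1 \<le> l1" "l2 \<le> j2" unfolding j1_def j2_def using fA l by (auto intro: Min_le Max_ge)
        then have j12: "j1 + 8 * q \<le> j2" using l(3) by linarith
        have "?A \<subseteq> {j1..j2}" using fA by (auto simp: j1_def j2_def intro: Min_le Max_ge)
        then have "card ?A \<le> card {j1..j2}" by (intro card_mono) auto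
        then have cA: "card ?A \<le> j2 - j1 + 1" using j12 by simp
        have j1: "j1 \<in> Jc" "asg j1 = y" and j2: "j2 \<in> Jc" "asg j2 = y" using jA by (auto simp: JL_def)
        obtain b1 where b1: "b1 < k" "scc (y b1) = scc (?x j1)" using asg(2)[OF j1(1)] j1(2) by blast
        obtain b2 where b2: "b2 < k" "scc (y b2) = scc (?x j2)" using asg(2)[OF j2(1)] j2(2) by blast
        have gy: "geod y k" using FG[OF PF] asg(1)[OF j1(1)] j1(2) by blast
        have xx: "?x j1 \<in> W" "?x j2 \<in> W" using xW j1(1) j2(1) by (auto simp: Jc_def)
        have jd: "j2 \<le> d p" using J2r[of j2] j2(1) a(2) by (auto simp: Jc_def)
        have "real (j2 - j1 + 1) / 4 \<le> (\<Sum>j\<in>{j. Suc j * q < k}. real (gain (y (j * q), y (Suc j * q)) p))"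
          by (rule block_gain[OF X[OF p] gy, of "2 * \<mu>" q j1 j2 b1 b2])
            (use j12 jd b1 b2 Wsz[OF xx(1)] Wsz[OF xx(2)] in_scc[OF j1(1) b1(1)] in_scc[OF j2(1) b2(1)] j1 j2
              in \<open>auto simp: q_def\<close>)
        then have "real (j2 - j1 + 1) / 4 \<le> (\<Sum>j\<in>{j. Suc j * q < k}. real (gain (eB (y, j)) p))"
          by (simp add: eB_def)
        moreover have "real (card ?A) / 4 \<le> real (j2 - j1 + 1) / 4"
          using cA by (intro divide_right_mono of_nat_mono) auto
        ultimately show ?thesis by (rule order_trans[rotated])
      qed
      have "real (card JL) / 4 = (\<Sum>y\<in>asg ` JL. real (card {j\<in>JL. asg j = y}) / 4)"
        using sum.image_gen[OF fJL, of "\<lambda>_. 1 / 4 :: real" asg] by simp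
      also have "\<dots> \<le> (\<Sum>y\<in>asg ` JL. \<Sum>j\<in>{j. Suc j * q < k}. real (gain (eB (y, j)) p))"
        using each by (rule sum_mono)
      also have "\<dots> \<le> (\<Sum>y\<in>\<P>. \<Sum>j\<in>{j. Suc j * q < k}. real (gain (eB (y, j)) p))"
        by (rule sum_mono2[OF fP]) (use asg(1) in \<open>auto simp: JL_def intro: sum_nonneg\<close>)
      also have "\<dots> = (\<Sum>e\<in>IB. real (gain (eB e) p))"
        unfolding IB_def by (simp add: sum.cartesian_product case_prod_beta)
      finally have g: "real (card JL) / 4 \<le> \<dots>" .
      have "?k / (32 * ?m) \<le> real (card JL) / 4" using L by simp
      with g have "?k / (32 * ?m) \<le> (\<Sum>e\<in>IB. real (gain (eB e) p))" by linarith
      then have "p \<in> served IB eB BB" using BB dB by (intro servedI[OF p]) auto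
      then show False using np by blast
    qed
    have JS: "?k / (8 * ?m) \<le> real (card JS)"
    proof -
      have "?k / (4 * ?m) = ?k / (8 * ?m) + ?k / (8 * ?m)" by simp
      then show ?thesis using Jc JLsmall cLS by linarith
    qed
    have fJS: "finite JS" using fJc by (simp add: JS_def)
    define t2 where "t2 = real (card (asg ` JS))"
    have "real (card JS) \<le> real (9 * q) * t2" unfolding t2_def
    proof (rule card_le_mult_card_image[OF fJS])
      fix y assume y: "y \<in> asg ` JS"
      let ?A = "{j\<in>JS. asg j = y}"
      have nl: "\<not> lng y" and sub: "?A \<subseteq> ?fib y" using y by (auto simp: JS_def)
      have ne: "?A \<noteq> {}" and fA: "finite ?A" using y fJS by auto
      have "?A \<subseteq> {Min ?A ..< Min ?A + 8 * q}"
      proof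
        fix j assume j: "j \<in> ?A"
        have "Min ?A \<in> ?fib y" using Min_in[OF fA ne] sub by blast
        then have "\<not> Min ?A + 8 * q \<le> j" using nl j sub unfolding lng_def by blast
        then show "j \<in> {Min ?A ..< Min ?A + 8 * q}" using Min_le[OF fA j] by simp
      qed
      then have "card ?A \<le> card {Min ?A ..< Min ?A + 8 * q}" by (intro card_mono) auto
      then have "card ?A \<le> 9 * q" by simp
      then show "real (card ?A) \<le> real (9 * q)" by (rule of_nat_mono)
    qed
    then have "?k / (8 * ?m) \<le> 9 * real q * t2" using JS by simp
    then have t2: "?k / (72 * ?m * q) \<le> t2" using k0 qpos by (simp add: field_simps)

    have "t1 * t2 * real k \<le> (\<Sum>(S, y)\<in>IC. real (gain (rep S, v S y) p))"
      unfolding t1_def t2_def IC_def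
    proof (rule cross_gain[OF X[OF p], where \<alpha> = k and \<gamma> = "2 * k"])
      have JS2: "JS \<subseteq> J2" by (auto simp: JS_def Jc_def)
      show "J1 \<subseteq> {..d p}" "JS \<subseteq> {..d p}" using JS2 J1(1) J2(1) hit(1)[OF a1k] hit(1)[OF a(2)] by blast+
      show "(\<lambda>j. scc (?x j)) ` J1 \<subseteq> U" using xW by (auto simp: U_def)
      show "asg ` JS \<subseteq> \<P>" using asg(1) by (auto simp: JS_def)
      fix l assume l: "l \<in> J1"
      have lW: "?x l \<in> W" using xW l by blast
      have lV: "?x l \<in> V" using lW W(1) by blast
      show "T (?x l) (rep (scc (?x l))) \<and> \<delta> (?x l) (rep (scc (?x l))) \<le> k"
        using scc_diam[OF scc_refl[OF lV] rep[OF lV]] Wsz(3)[OF lW] by simp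
      fix j assume j: "j \<in> JS"
      have jc: "j \<in> Jc" using j by (simp add: JS_def)
      have ij: "a1 \<le> l" "l < a1 + k" "a2 \<le> j" "j < a2 + k"
        using l J1(1) J2r[of j] JS2 j by (auto simp: hits_def)
      then show "l + k + 1 + 2 * k + k \<le> j" using a by linarith
      let ?u = "rep (scc (?x l))" and ?y = "asg j"
      obtain b where b: "b < k" "scc (?y b) = scc (?x j)" using asg(2)[OF jc] by blast
      have s: "?x j \<in> scc (?y b)" "?y b \<in> scc (?x j)" using in_scc[OF jc b] by auto
      have gy: "geod ?y k" using FG[OF PF[OF asg(1)[OF jc]]] .
      have Txx: "T (?x l) (?x j)" using geodD[OF gx, of l j] ij a by simp
      have Tu: "T ?u (?x l)" using rep[OF lV] by (simp add: scc_def)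
      have Ty: "T (?x j) (?y b)" using s(1) by (simp add: scc_def)
      have Tuy: "T ?u (?y b)" using T_trans[OF T_trans[OF Tu Txx] Ty] .
      \<comment> \<open>The geodesic meets the block at \<open>b\<close>, so the first reachable
        position is no later. The way on costs at most \<open>k\<close> along the block and at most
        \<open>k\<close> inside the component of \<open>x j\<close>.\<close>
      let ?a = "LEAST a. T ?u (?y a)"
      have ab: "?a \<le> b" using Tuy by (rule Least_le)
      have veq: "v (scc (?x l)) ?y = ?y ?a" unfolding v_def using b(1) Tuy by auto
      have 1: "T (?y ?a) (?y b)" "\<delta> (?y ?a) (?y b) \<le> k" using geodD[OF gy ab] b(1) by auto
      have jW: "?x j \<in> W" using xW JS2 j by blast
      have "\<delta> (?y b) (?x j) < card (scc (?x j))"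
        using scc_diam[OF s(2), of "?x j"] scc_refl[of "?x j"] jW W(1) by blast
      then have 2: "T (?y b) (?x j)" "\<delta> (?y b) (?x j) \<le> k"
        using Wsz(3)[OF jW] s(1) by (auto simp: scc_def)
      show "T (v (scc (?x l)) ?y) (?x j) \<and> \<delta> (v (scc (?x l)) ?y) (?x j) \<le> 2 * k"
        using T_trans[OF 1(1) 2(1)] d_tri[OF 1(1) 2(1)] 1(2) 2(2) unfolding veq by simp
    qed (use fU fP in auto)
    moreover have "rate * BC * (64 * m * k) \<le> t1 * t2 * real k"
    proof -
      have "rate * BC * (64 * m * k)
          \<le> ?k ^ 3 / (?n ^ 2 * R) / (2 ^ 25 * ?m ^ 4) * BC * (64 * m * k)"
        using rate_le_k BC by (intro mult_right_mono) auto
      also have "\<dots> = 256 * ?k ^ 3 * \<eta> / (?R * ?\<mu>\<^sup>2 * 2 ^ 25 * ?m\<^sup>2)"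
        using n_pos k0 \<eta> by (simp add: BC_def \<nu>_def field_simps power_def numeral_eq_Suc)
      \<comment> \<open>Expanding by \<open>\<eta> * q\<close> exposes the product bounded by
        \<open>\<eta>q\<close> and leaves the denominators of \<open>t1\<close> and
        \<open>t2\<close>.\<close>
      also have "\<dots> = 256 * ?k ^ 3 * (\<eta>\<^sup>2 * q) / ((?R * ?\<mu>\<^sup>2) * (2 ^ 25 * ?m\<^sup>2 * \<eta> * q))"
        using k0 \<eta> qpos by (simp add: field_simps power_def numeral_eq_Suc)
      also have "\<dots> \<le> 256 * ?k ^ 3 * (910 * ?\<mu>\<^sup>2 * ?R) / ((?R * ?\<mu>\<^sup>2) * (2 ^ 25 * ?m\<^sup>2 * \<eta> * q))"
        using \<eta>q k0 \<eta> by (intro divide_right_mono mult_left_mono) auto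
      also have "\<dots> = ?k ^ 3 * (256 * 910 / 2 ^ 25) / (?m\<^sup>2 * \<eta> * q)"
        using k0 \<eta> qpos by (simp add: field_simps)
      also have "\<dots> \<le> ?k ^ 3 * (1 / 144) / (?m\<^sup>2 * \<eta> * q)"
        using k0 \<eta> qpos by (intro divide_right_mono mult_left_mono) auto
      also have "\<dots> = (?k / (2 * ?m * \<eta>)) * (?k / (72 * ?m * q)) * ?k"
        by (simp add: power_def numeral_eq_Suc mult_ac)
      also have "\<dots> \<le> t1 * t2 * ?k"
        using t1 t2 k0 \<eta> qpos by (intro mult_right_mono mult_mono) (auto simp: t1_def)
      finally show ?thesis .
    qed
    ultimately have "p \<in> served IC eC BC" using BC
      by (intro servedI[OF p, where c = "t1 * t2 * real k"]) (auto simp: eC_def case_prod_beta)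
    then show False using np by blast
  qed
  then show ?thesis using GD GB GC
    by (intro exI[of _ ?GD] exI[of _ "served IB eB BB"] exI[of _ "served IC eC BC"])
      (auto simp: served_def)
qed


text \<open>Two applications of the pigeonhole principle: each of the \<open>m + 1\<close> blocks
  starting at multiples of \<open>8 * k\<close> has a class with at least \<open>k / m\<close> hits,
  and two of the blocks share this class.\<close>

lemma ex_two_blocks:
  assumes p: "p \<in> \<Gamma>" and cls: "\<And>w. w \<in> V \<Longrightarrow> cls w < m" and len: "8 * (m + 1) * k \<le> d p"
  shows "\<exists>c<m. p \<in> two_blocks c"
proof -
  have gx: "geod (X p) (d p)" using X[OF p] by (simp add: joins_def)
  have fits: "8 * b * k + k \<le> d p" if "b \<le> m" for b
  proof -
    have "8 * b * k \<le> 8 * m * k" using that by simp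
    moreover have "8 * (m + 1) * k = 8 * m * k + 8 * k" by (simp add: algebra_simps)
    ultimately show ?thesis using len by linarith
  qed
  have "\<exists>c<m. k \<le> m * card (hits c p (8 * b * k))" if b: "b \<le> m" for b
  proof (rule ccontr)
    assume "\<not> ?thesis"
    then have lt: "m * card (hits c p (8 * b * k)) < k" if "c < m" for c
      using that by (simp add: not_le)
    let ?J = "{8 * b * k..<8 * b * k + k}"
    have "(\<lambda>j. cls (X p j)) ` ?J \<subseteq> {..<m}"
      using geod_in_V[OF gx] fits[OF b] cls by fastforce
    then have "k = (\<Sum>c<m. card {j\<in>?J. cls (X p j) = c})"
      using sum.group[of ?J "{..<m}" "\<lambda>j. cls (X p j)" "\<lambda>_. 1 :: nat"] by simp
    then have "m * k = (\<Sum>c<m. m * card (hits c p (8 * b * k)))"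
      unfolding hits_def sum_distrib_left[symmetric] by (rule arg_cong)
    also have "\<dots> < (\<Sum>c<m. k)" by (rule sum_strict_mono) (use m lt in \<open>auto simp: lessThan_empty_iff\<close>)
    finally show False by simp
  qed
  then have "\<forall>b\<in>{..m}. \<exists>c. c < m \<and> k \<le> m * card (hits c p (8 * b * k))" by blast
  from bchoice[OF this] obtain c
    where c: "\<forall>b\<in>{..m}. c b < m \<and> k \<le> m * card (hits (c b) p (8 * b * k))" by blast
  have "\<not> inj_on c {..m}"
  proof
    assume "inj_on c {..m}"
    then have "card {..m} \<le> card {..<m}" by (rule card_inj_on_le) (use c in auto)
    then show False by simp
  qed
  then obtain b1 b2 where b: "b1 \<le> m" "b2 \<le> m" "b1 < b2" "c b1 = c b2"
    unfolding inj_on_def by (metis atMost_iff linorder_neqE_nat)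
  have "8 * b1 * k + 8 * k = 8 * (b1 + 1) * k" by (simp add: algebra_simps)
  also have "\<dots> \<le> 8 * b2 * k" using b(3) by (intro mult_le_mono1) simp
  finally have "8 * b1 * k + 8 * k \<le> 8 * b2 * k" .
  moreover have "k \<le> m * card (hits (c b1) p (8 * b1 * k))" using c b(1) by blast
  moreover have "k \<le> m * card (hits (c b1) p (8 * b2 * k))" unfolding b(4) using c b(2) by blast
  ultimately have "p \<in> two_blocks (c b1)"
    unfolding two_blocks_def mem_Collect_eq using p fits[OF b(2)]
    by (intro conjI exI[of _ "8 * b1 * k"] exI[of _ "8 * b2 * k"])
  then show ?thesis using c b(1) by auto
qed

text \<open>Every pair has a class with two blocks, and each of the \<open>m\<close> classes is
  handled by three families; this explains the loss of \<open>3 * m\<close>.\<close>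

lemma cheap_all:
  assumes ne: "\<Gamma> \<noteq> {}" and cls: "\<And>w. w \<in> V \<Longrightarrow> cls w < m"
    and len: "\<And>p. p \<in> \<Gamma> \<Longrightarrow> 8 * (m + 1) * k \<le> d p"
  shows "cheap \<Gamma> (rate / (3 * m)) \<Gamma>"
proof -
  have "\<forall>c. \<exists>H :: nat \<Rightarrow> ('a \<times> 'a) set.
      (\<forall>r<3. cheap \<Gamma> rate (H r) \<and> H r \<subseteq> \<Gamma>) \<and> two_blocks c \<subseteq> (\<Union>r<3. H r)"
  proof
    fix c
    obtain G1 G2 G3 where G: "cheap \<Gamma> rate G1" "cheap \<Gamma> rate G2" "cheap \<Gamma> rate G3"
      "two_blocks c \<subseteq> G1 \<union> G2 \<union> G3" "G1 \<union> G2 \<union> G3 \<subseteq> \<Gamma>"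
    proof (cases c)
      case 0
      then show ?thesis using big_class that by blast
    next
      case (Suc i)
      then show ?thesis using small_class[of i] that by blast
    qed
    let ?H = "\<lambda>r :: nat. if r = 0 then G1 else if r = 1 then G2 else G3"
    have "(\<Union>r<3. ?H r) = G1 \<union> G2 \<union> G3"
      by (auto simp: numeral_3_eq_3 lessThan_Suc)
    then show "\<exists>H :: nat \<Rightarrow> ('a \<times> 'a) set.
      (\<forall>r<3. cheap \<Gamma> rate (H r) \<and> H r \<subseteq> \<Gamma>) \<and> two_blocks c \<subseteq> (\<Union>r<3. H r)"
      using G by (intro exI[of _ ?H]) auto
  qed
  from choice[OF this] obtain H :: "nat \<Rightarrow> nat \<Rightarrow> ('a \<times> 'a) set"
    where H: "\<forall>c. (\<forall>r<3. cheap \<Gamma> rate (H c r) \<and> H c r \<subseteq> \<Gamma>) \<and> two_blocks c \<subseteq> (\<Union>r<3. H c r)" ..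
  show ?thesis
  proof (rule cheap_Union[OF finite_\<Gamma> ne, where F = "{..<m} \<times> {..<3}" and G = "\<lambda>(c, r). H c r"])
    show "\<Gamma> \<subseteq> (\<Union>f\<in>{..<m} \<times> {..<3}. case f of (c, r) \<Rightarrow> H c r)"
    proof
      fix p assume p: "p \<in> \<Gamma>"
      obtain c where c: "c < m" "p \<in> two_blocks c"
        using ex_two_blocks[OF p cls len[OF p]] by blast
      then obtain r where "r < 3" "p \<in> H c r" using H by blast
      then show "p \<in> (\<Union>f\<in>{..<m} \<times> {..<3}. case f of (c, r) \<Rightarrow> H c r)" using c(1) by blast
    qed
    show "cheap \<Gamma> rate (case f of (c, r) \<Rightarrow> H c r)" if "f \<in> {..<m} \<times> {..<3}" for f
      using H that by auto
    show "finite (case f of (c, r) \<Rightarrow> H c r)" if "f \<in> {..<m} \<times> {..<3}" for f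
      using H that finite_subset[OF _ finite_\<Gamma>] by auto
  qed (simp_all add: rate_nonneg)
qed

end

section \<open>The claimed size without its logarithms\<close>

definition size_bound :: "real \<Rightarrow> real \<Rightarrow> real" where
  "size_bound n \<beta> = n powr (3/2) / \<beta> powr (3/2) + n ^ 2 / \<beta> ^ 3"

lemma size_bound_pos: "n > 0 \<Longrightarrow> \<beta> > 0 \<Longrightarrow> size_bound n \<beta> > 0"
  unfolding size_bound_def by (intro add_pos_pos divide_pos_pos) auto

lemma size_bound_alt:
  assumes "n > 0" "\<beta> > 0"
  shows "size_bound n \<beta> = n / sqrt (\<beta> ^ 3 / n) + n / (\<beta> ^ 3 / n)"
proof -
  have "sqrt (\<beta> ^ 3) = (\<beta> powr 3) powr (1/2)"
    using assms powr_realpow[of \<beta> 3] by (simp add: powr_half_sqrt)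
  then have "sqrt (\<beta> ^ 3) = \<beta> powr (3/2)" by (simp add: powr_powr)
  then have "sqrt (\<beta> ^ 3 / n) = \<beta> powr (3/2) / n powr (1/2)"
    using assms by (simp add: real_sqrt_divide powr_half_sqrt)
  moreover have "n powr (3/2) = n * n powr (1/2)"
    using assms powr_add[of n 1 "1/2"] by simp
  ultimately show ?thesis using assms by (simp add: size_bound_def power2_eq_square)
qed

text \<open>Underestimating the length by a factor \<open>c\<close> costs at most
  \<open>c ^ 3\<close>. It is used for passing from a distance to the block length, and with
  \<open>c = 1\<close> as monotonicity.\<close>

lemma size_bound_antimono:
  assumes "n > 0" "\<beta> > 0" "c \<ge> 1" "\<beta> \<le> c * k"
  shows "size_bound n k \<le> c ^ 3 * size_bound n \<beta>"
proof -
  have "0 < c * k" using assms by linarith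
  then have k: "k > 0" using assms(3) by (simp add: zero_less_mult_iff)
  have 1: "n ^ 2 / k ^ 3 \<le> c ^ 3 * (n ^ 2 / \<beta> ^ 3)"
  proof -
    have "\<beta> ^ 3 \<le> (c * k) ^ 3" using assms by (intro power_mono) auto
    then have "n ^ 2 * \<beta> ^ 3 \<le> n ^ 2 * (c ^ 3 * k ^ 3)"
      by (intro mult_left_mono) (auto simp: power_mult_distrib)
    then show ?thesis using assms k by (simp add: field_simps)
  qed
  have 2: "n powr (3/2) / k powr (3/2) \<le> c ^ 3 * (n powr (3/2) / \<beta> powr (3/2))"
  proof -
    have "\<beta> powr (3/2) \<le> (c * k) powr (3/2)" using assms by (intro powr_mono2) auto
    also have "\<dots> = c powr (3/2) * k powr (3/2)" using assms k by (simp add: powr_mult)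
    also have "\<dots> \<le> c powr 3 * k powr (3/2)" using assms by (intro mult_right_mono powr_mono) auto
    also have "c powr 3 = c ^ 3" using assms powr_realpow[of c 3] by simp
    finally have "n powr (3/2) * \<beta> powr (3/2) \<le> n powr (3/2) * (c ^ 3 * k powr (3/2))"
      by (intro mult_left_mono) auto
    then show ?thesis using assms k by (simp add: field_simps)
  qed
  show ?thesis unfolding size_bound_def distrib_left using 1 2 by linarith
qed

text \<open>The fractions \<open>R / n\<close> (pairs within a part, edges along a block) and \<open>k\<^sup>3 / (n\<^sup>2 R)\<close>
  (edges between parts or to blocks) balance at this value of \<open>R\<close>.\<close>

lemma balanced_R:
  fixes n k :: nat
  assumes "n > 0" "k > 0"
  defines "R \<equiv> max 1 (nat \<lfloor>sqrt (real k ^ 3 / n)\<rfloor>)"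
  shows "1 / (2 * size_bound n k) \<le> min (real R / n) (real k ^ 3 / (real n ^ 2 * R))"
proof -
  define x where "x = real k ^ 3 / n"
  have x: "x > 0" using assms by (simp add: x_def)
  define y where "y = sqrt x"
  have y: "y > 0" "y * y = x" using x by (simp_all add: y_def)
  have R: "R = max 1 (nat \<lfloor>y\<rfloor>)" by (simp add: R_def x_def y_def)
  have R1: "real R \<ge> 1" by (simp add: R)
  define z where "z = real (nat \<lfloor>y\<rfloor>)"
  have z: "z \<le> y" "z > y - 1" unfolding z_def using y by linarith+
  have "real R = max 1 z" by (simp add: R z_def of_nat_max del: of_nat_nat)
  \<comment> \<open>Rounding down and the lower limit 1 keep \<open>R\<close> between
    \<open>y / 2\<close> and \<open>1 + y\<close>, which is all that the two estimates use.\<close>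
  then have R2: "real R \<le> 1 + y" "real R \<ge> y / 2" using y(1) z by (auto simp: max_def)
  have sb: "size_bound n k = n / y + n / x"
    using size_bound_alt[of n k] assms by (simp add: x_def y_def)
  have sbp: "size_bound n k > 0" using assms by (intro size_bound_pos) auto
  have "real n \<le> R * (2 * size_bound n k)"
  proof -
    have "real n = y / 2 * (2 * (n / y))" using y by simp
    also have "\<dots> \<le> R * (2 * size_bound n k)"
      using R2 y x assms unfolding sb by (intro mult_mono) auto
    finally show ?thesis .
  qed
  then have 1: "1 / (2 * size_bound n k) \<le> real R / n" using sbp assms by (simp add: field_simps)
  have "real n * R \<le> x * (2 * size_bound n k)"
  proof -
    have "real n * R \<le> n * (1 + y)" using R2 by (intro mult_left_mono) auto
    also have "\<dots> = x * (n / y + n / x)"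
    proof -
      have "x * (n / y) = n * y" unfolding y(2)[symmetric] using y(1) by simp
      then show ?thesis using x by (simp add: distrib_left)
    qed
    also have "\<dots> \<le> x * (2 * size_bound n k)" using sbp x unfolding sb by (intro mult_left_mono) auto
    finally show ?thesis .
  qed
  then have "real n * R * n \<le> real k ^ 3 * (2 * size_bound n k)" using assms by (simp add: x_def field_simps)
  then have 2: "1 / (2 * size_bound n k) \<le> real k ^ 3 / (real n ^ 2 * R)"
    using sbp assms R1 by (simp add: field_simps power2_eq_square)
  show ?thesis using 1 2 by simp
qed

section \<open>An edge of large gain, first for one dyadic distance range and then for all\<close>

context hop_metric
begin

lemma cheap_mono:
  assumes "cheap \<Gamma>' \<tau>' G" "\<tau> \<le> \<tau>'" "\<Gamma>' \<subseteq> \<Gamma>" "finite \<Gamma>"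
  shows "cheap \<Gamma> \<tau> G"
proof -
  obtain e where e: "T (fst e) (snd e)"
    "\<tau>' * (\<Sum>p\<in>G. real (\<delta> (fst p) (snd p))) \<le> (\<Sum>p\<in>\<Gamma>'. real (gain e p))"
    using assms(1) unfolding cheap_def by blast
  have "\<tau> * (\<Sum>p\<in>G. real (\<delta> (fst p) (snd p))) \<le> \<tau>' * (\<Sum>p\<in>G. real (\<delta> (fst p) (snd p)))"
    using assms(2) by (intro mult_right_mono sum_nonneg) auto
  moreover have "(\<Sum>p\<in>\<Gamma>'. real (gain e p)) \<le> (\<Sum>p\<in>\<Gamma>. real (gain e p))"
    using assms(3,4) by (intro sum_mono2) auto
  ultimately show ?thesis using e unfolding cheap_def by (intro exI[of _ e]) linarith
qed

lemma \<delta>_less: "T u v \<Longrightarrow> \<delta> u v < card V"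
proof -
  assume T: "T u v"
  then obtain x :: "nat \<Rightarrow> 'a" where x: "geod x (\<delta> u v)"
    using geodesic_ex unfolding geod_def by blast
  have "x ` {..\<delta> u v} \<subseteq> V" using geod_in_V[OF x] by auto
  then have "card (x ` {..\<delta> u v}) \<le> card V" by (rule card_mono[OF finite_V])
  then show ?thesis using card_image[OF geod_inj[OF x]] by simp
qed

lemma shortening_edge_dyadic:
  assumes \<Gamma>: "finite \<Gamma>" "\<Gamma> \<noteq> {}" and T: "\<And>p. p \<in> \<Gamma> \<Longrightarrow> T (fst p) (snd p)"
    and D: "\<And>p. p \<in> \<Gamma> \<Longrightarrow> D \<le> \<delta> (fst p) (snd p) \<and> \<delta> (fst p) (snd p) < 2 * D"
    and mD: "m = floor_log (card V) + 2" "8 * (m + 1) \<le> D"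
  shows "cheap \<Gamma> (1 / (3 * 2 ^ 41 * real m ^ 8 * size_bound (card V) D)) \<Gamma>"
proof -
  obtain p0 where "p0 \<in> \<Gamma>" using \<Gamma> by blast
  then have V: "V \<noteq> {}" using T T_in_V by blast
  let ?n = "card V"
  have n: "?n > 0" using V finite_V by (simp add: card_gt_0_iff)
  have "\<forall>p\<in>\<Gamma>. \<exists>x. joins x p" using geodesic_ex[OF T] unfolding joins_def geod_def by blast
  from bchoice[OF this] obtain X where X: "\<forall>p\<in>\<Gamma>. joins (X p) p" by blast
  \<comment> \<open>The largest block length for which \<open>m + 1\<close> blocks at spacing
    \<open>8 * k\<close>, with one spacing to spare, fit into every geodesic.\<close>
  define k where "k = D div (8 * (m + 1))"
  have m: "m \<ge> 1" using mD by simp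
  have k: "k \<ge> 1" using mD(2) by (simp add: k_def less_eq_div_iff_mult_less_eq del: mult_Suc_right)
  have kD: "8 * (m + 1) * k \<le> D" by (simp add: k_def)
  have "D < 8 * (m + 1) * (k + 1)"
    using dividend_less_div_times[of "8 * (m + 1)" D] by (simp add: k_def algebra_simps)
  also have "\<dots> \<le> 8 * (2 * m) * (2 * k)" using m k by (intro mult_mono) auto
  finally have Dk: "D < 32 * m * k" by simp
  define R where "R = max 1 (nat \<lfloor>sqrt (real k ^ 3 / ?n)\<rfloor>)"
  interpret hop_pairs V T \<delta> \<Gamma> X k m R
  proof
    fix p assume "p \<in> \<Gamma>"
    then show "\<delta> (fst p) (snd p) \<le> 64 * m * k" using D[of p] Dk by simp
  qed (use \<Gamma> X k m V in \<open>auto simp: R_def\<close>)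
  have "cheap \<Gamma> (rate / (3 * m)) \<Gamma>"
  proof (rule cheap_all[OF \<Gamma>(2)])
    fix w assume w: "w \<in> V"
    have "floor_log (card (scc w)) \<le> floor_log ?n"
      by (intro floor_log_le_iff card_mono finite_V scc_subset)
    then show "cls w < m" by (simp add: cls_def mD(1))
  next
    fix p assume "p \<in> \<Gamma>"
    then show "8 * (m + 1) * k \<le> \<delta> (fst p) (snd p)" using D[of p] kD by linarith
  qed
  moreover have "1 / (3 * 2 ^ 41 * real m ^ 8 * size_bound ?n D) \<le> rate / (3 * m)"
  proof -
    have D0: "real D > 0" using mD by simp
    have sk: "size_bound ?n k > 0" and sD: "size_bound ?n D > 0"
      using n k D0 by (auto intro!: size_bound_pos)
    have "size_bound ?n k \<le> (32 * real m) ^ 3 * size_bound ?n D"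
    proof (rule size_bound_antimono)
      have "real D \<le> real (32 * m * k)" using Dk by (intro of_nat_mono) simp
      then show "real D \<le> 32 * real m * real k" by simp
    qed (use n D0 m in auto)
    \<comment> \<open>The factors come from \<open>balanced_R\<close> (2), from replacing
      \<open>k\<close> by \<open>D\<close> (the cube of \<open>32 * m\<close>), from
      \<open>rate\<close>, and from \<open>cheap_all\<close>.\<close>
    then have "2 * size_bound ?n k * (2 ^ 25 * real m ^ 4) * (3 * m)
        \<le> 2 * ((32 * real m) ^ 3 * size_bound ?n D) * (2 ^ 25 * real m ^ 4) * (3 * m)"
      by (intro mult_right_mono mult_left_mono) auto
    also have "\<dots> = 3 * 2 ^ 41 * real m ^ 8 * size_bound ?n D"
      by (simp add: power_mult_distrib power_def numeral_eq_Suc)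
    finally have "1 / (3 * 2 ^ 41 * real m ^ 8 * size_bound ?n D)
        \<le> 1 / (2 * size_bound ?n k * (2 ^ 25 * real m ^ 4) * (3 * m))"
      using sk sD m by (intro divide_left_mono mult_pos_pos) auto
    also have "\<dots> = 1 / (2 * size_bound ?n k) / (2 ^ 25 * real m ^ 4) / (3 * m)" by simp
    also have "\<dots> \<le> rate / (3 * m)"
    proof -
      have "1 / (2 * size_bound ?n k) \<le> min (real R / ?n) (real k ^ 3 / (real ?n ^ 2 * R))"
        unfolding R_def using n k by (intro balanced_R) auto
      then show ?thesis unfolding rate_def by (intro divide_right_mono) auto
    qed
    finally show ?thesis .
  qed
  ultimately show ?thesis by (rule cheap_mono) (use \<Gamma> in auto)
qed

text \<open>Distances are below \<open>card V\<close>, so \<open>m\<close> dyadic ranges starting at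
  \<open>\<beta>\<close> suffice, at the cost of another factor \<open>m\<close>. The bound for the
  range at \<open>\<beta>\<close> is the weakest.\<close>

lemma shortening_edge:
  assumes \<Gamma>: "finite \<Gamma>" "\<Gamma> \<noteq> {}" and T: "\<And>p. p \<in> \<Gamma> \<Longrightarrow> T (fst p) (snd p)"
    and \<beta>: "\<And>p. p \<in> \<Gamma> \<Longrightarrow> \<beta> \<le> \<delta> (fst p) (snd p)"
    and m\<beta>: "m = floor_log (card V) + 2" "8 * (m + 1) \<le> \<beta>"
  shows "cheap \<Gamma> (1 / (3 * 2 ^ 41 * real m ^ 9 * size_bound (card V) \<beta>)) \<Gamma>"
proof -
  let ?d = "\<lambda>p. \<delta> (fst p) (snd p)"
  let ?n = "card V"
  obtain p0 where "p0 \<in> \<Gamma>" using \<Gamma> by blast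
  then have "V \<noteq> {}" using T T_in_V by blast
  then have n: "?n > 0" using finite_V by (simp add: card_gt_0_iff)
  define G where "G i = {p\<in>\<Gamma>. \<beta> * 2 ^ i \<le> ?d p \<and> ?d p < 2 * (\<beta> * 2 ^ i)}" for i
  define \<tau> where "\<tau> = 1 / (3 * 2 ^ 41 * real m ^ 8 * size_bound ?n \<beta>)"
  have \<beta>0: "\<beta> > 0" and m: "m \<ge> 1" using m\<beta> by auto
  have sb: "size_bound ?n \<beta> > 0" using n \<beta>0 by (intro size_bound_pos) auto
  have \<tau>: "\<tau> \<ge> 0" using sb by (simp add: \<tau>_def)
  have c: "cheap \<Gamma> \<tau> (G i)" if "G i \<noteq> {}" for i
  proof -
    have "cheap (G i) (1 / (3 * 2 ^ 41 * real m ^ 8 * size_bound ?n (\<beta> * 2 ^ i))) (G i)"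
    proof (rule shortening_edge_dyadic[OF _ that _ _ m\<beta>(1)])
      have "8 * (m + 1) * 1 \<le> \<beta> * 2 ^ i" using m\<beta>(2) by (intro mult_mono) auto
      then show "8 * (m + 1) \<le> \<beta> * 2 ^ i" by simp
    qed (use \<Gamma> T in \<open>auto simp: G_def\<close>)
    moreover have "\<tau> \<le> 1 / (3 * 2 ^ 41 * real m ^ 8 * size_bound ?n (\<beta> * 2 ^ i))"
    proof -
      have "size_bound ?n (\<beta> * 2 ^ i) \<le> 1 ^ 3 * size_bound ?n \<beta>"
        using n \<beta>0 by (intro size_bound_antimono) auto
      moreover have "size_bound ?n (\<beta> * 2 ^ i) > 0" using n \<beta>0 by (intro size_bound_pos) auto
      ultimately show ?thesis unfolding \<tau>_def
        using m by (intro divide_left_mono mult_left_mono mult_pos_pos) auto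
    qed
    ultimately show ?thesis by (rule cheap_mono) (use \<Gamma> in \<open>auto simp: G_def\<close>)
  qed
  have "cheap \<Gamma> (\<tau> / m) \<Gamma>"
  proof (rule cheap_Union[OF \<Gamma>, where F = "{i\<in>{..<m}. G i \<noteq> {}}" and G = G])
    show "\<Gamma> \<subseteq> (\<Union>i\<in>{i\<in>{..<m}. G i \<noteq> {}}. G i)"
    proof
      fix p assume p: "p \<in> \<Gamma>"
      define i where "i = floor_log (?d p div \<beta>)"
      have pos: "?d p div \<beta> > 0" using \<beta>[OF p] \<beta>0 by (simp add: div_greater_zero_iff)
      have i: "2 ^ i \<le> ?d p div \<beta>" "?d p div \<beta> < 2 * 2 ^ i"
        unfolding i_def using pos floor_log_exp2_le floor_log_exp2_gt by auto
      have "?d p < ?n" using \<delta>_less[OF T[OF p]] .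
      then have "?d p div \<beta> \<le> ?n" using div_le_dividend[of "?d p" \<beta>] by linarith
      then have "i < m" unfolding i_def m\<beta>(1) using floor_log_le_iff[of "?d p div \<beta>" ?n] by linarith
      moreover have "\<beta> * 2 ^ i \<le> ?d p"
        using i(1) \<beta>0 by (simp add: less_eq_div_iff_mult_less_eq mult.commute)
      moreover have "?d p < 2 * (\<beta> * 2 ^ i)"
        using i(2) \<beta>0 by (simp add: div_less_iff_less_mult mult_ac)
      ultimately have "i < m" "p \<in> G i" using p by (auto simp: G_def)
      then show "p \<in> (\<Union>i\<in>{i\<in>{..<m}. G i \<noteq> {}}. G i)" by blast
    qed
    show "card {i \<in> {..<m}. G i \<noteq> {}} \<le> m"
      using card_mono[of "{..<m}" "{i \<in> {..<m}. G i \<noteq> {}}"] by auto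
  qed (use c \<tau> \<Gamma> in \<open>auto simp: G_def\<close>)
  moreover have "\<tau> / m = 1 / (3 * 2 ^ 41 * real m ^ 9 * size_bound ?n \<beta>)"
    by (simp add: \<tau>_def power_def numeral_eq_Suc mult_ac)
  ultimately show ?thesis by simp
qed

end

section \<open>The greedy algorithm\<close>

definition rdist :: "('a \<times> 'a) set \<Rightarrow> 'a \<Rightarrow> 'a \<Rightarrow> nat" where
  "rdist E u v = (LEAST k. (u, v) \<in> E ^^ k)"

lemma rdist_relpow: "(u, v) \<in> E\<^sup>* \<Longrightarrow> (u, v) \<in> E ^^ rdist E u v"
  unfolding rdist_def by (rule LeastI_ex) (simp add: rtrancl_power)

lemma rdist_le: "(u, v) \<in> E ^^ k \<Longrightarrow> rdist E u v \<le> k"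
  unfolding rdist_def by (rule Least_le)

lemma rdist_triangle:
  assumes "(u, v) \<in> E\<^sup>*" "(v, w) \<in> E\<^sup>*"
  shows "rdist E u w \<le> rdist E u v + rdist E v w"
  by (rule rdist_le) (auto simp: relpow_add intro: relcompI rdist_relpow assms)

lemma relpow_path:
  assumes f: "\<forall>i<n. (f i, f (Suc i)) \<in> E" and "i \<le> j" "j \<le> n"
  shows "(f i, f j) \<in> E ^^ (j - i)"
proof -
  have "(f i, f (i + l)) \<in> E ^^ l" if "i + l \<le> n" for l
    using that by (induction l) (use f in auto)
  from this[of "j - i"] show ?thesis using assms(2,3) by simp
qed

text \<open>The pieces of a shortest walk bound the three partial distances from above. By the
  triangle inequality they sum to at least the whole, so all three bounds are attained.\<close>

lemma rdist_geodesic: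
  assumes "(u, v) \<in> E\<^sup>*"
  shows "\<exists>x. x 0 = u \<and> x (rdist E u v) = v \<and>
    (\<forall>i j. i \<le> j \<longrightarrow> j \<le> rdist E u v \<longrightarrow> (x i, x j) \<in> E\<^sup>* \<and> rdist E (x i) (x j) = j - i)"
proof -
  let ?n = "rdist E u v"
  obtain f where f: "f 0 = u" "f ?n = v" "\<forall>i<?n. (f i, f (Suc i)) \<in> E"
    using rdist_relpow[OF assms] unfolding relpow_fun_conv by blast
  have "(f i, f j) \<in> E\<^sup>* \<and> rdist E (f i) (f j) = j - i" if ij: "i \<le> j" "j \<le> ?n" for i j
  proof -
    note p = relpow_path[OF f(3)]
    have r: "(u, f i) \<in> E\<^sup>*" "(f i, f j) \<in> E\<^sup>*" "(f j, v) \<in> E\<^sup>*"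
      using p[of 0 i] p[of i j] p[of j ?n] ij f(1,2) by (auto intro: relpow_imp_rtrancl)
    have "?n \<le> rdist E u (f i) + (rdist E (f i) (f j) + rdist E (f j) v)"
      using rdist_triangle[OF r(1) rtrancl_trans[OF r(2,3)]] rdist_triangle[OF r(2,3)] by linarith
    moreover have "rdist E u (f i) \<le> i" "rdist E (f i) (f j) \<le> j - i" "rdist E (f j) v \<le> ?n - j"
      using p[of 0 i] p[of i j] p[of j ?n] ij f(1,2) by (auto intro: rdist_le)
    ultimately show ?thesis using r(2) ij by linarith
  qed
  then show ?thesis using f(1,2) by blast
qed

lemma relpow_subset:
  fixes E E' :: "('a \<times> 'a) set"
  shows "E \<subseteq> E' \<Longrightarrow> E ^^ k \<subseteq> E' ^^ k"
  by (induction k) auto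

lemma rdist_mono: "(u, v) \<in> E\<^sup>* \<Longrightarrow> E \<subseteq> E' \<Longrightarrow> rdist E' u v \<le> rdist E u v"
  by (rule rdist_le, rule subsetD[OF relpow_subset], assumption, rule rdist_relpow)

lemma rdist_insert:
  assumes "(s, u) \<in> E\<^sup>*" "(v, t) \<in> E\<^sup>*"
  shows "rdist (insert (u, v) E) s t \<le> rdist E s u + 1 + rdist E v t"
proof -
  let ?E = "insert (u, v) E"
  have sub: "E\<^sup>* \<subseteq> ?E\<^sup>*" by (intro rtrancl_mono) auto
  have "(s, u) \<in> ?E\<^sup>*" "(u, v) \<in> ?E\<^sup>*" "(v, t) \<in> ?E\<^sup>*" using assms sub by auto
  then have "rdist ?E s t \<le> rdist ?E s u + (rdist ?E u v + rdist ?E v t)"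
    using rdist_triangle[of s u ?E t] rdist_triangle[of u v ?E t] rtrancl_trans[of u v ?E t] by linarith
  moreover have "rdist ?E u v \<le> 1" by (rule rdist_le) simp
  moreover have "rdist ?E s u \<le> rdist E s u" "rdist ?E v t \<le> rdist E v t"
    using assms by (auto intro: rdist_mono)
  ultimately show ?thesis by linarith
qed

text \<open>The conjunct \<open>u \<in> V\<close> is there because \<open>E\<^sup>*\<close> is
  reflexive on the whole type.\<close>

lemma hop_metric_rdist:
  assumes "finite V" "E \<subseteq> V \<times> V"
  shows "hop_metric V (\<lambda>u v. u \<in> V \<and> (u, v) \<in> E\<^sup>*) (rdist E)"
proof
  have in_V: "v \<in> V" if "(u, v) \<in> E\<^sup>*" "u \<in> V" for u v
    using that by (induction rule: rtrancl_induct) (use assms in auto)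
  then show "u \<in> V \<and> v \<in> V" if "u \<in> V \<and> (u, v) \<in> E\<^sup>*" for u v using that by blast
  show "rdist E u u = 0" for u using rdist_le[where k = 0 and u = u and v = u and E = E] by simp
  show "\<exists>x. x 0 = u \<and> x (rdist E u v) = v \<and> (\<forall>i j. i \<le> j \<longrightarrow> j \<le> rdist E u v \<longrightarrow>
      (x i \<in> V \<and> (x i, x j) \<in> E\<^sup>*) \<and> rdist E (x i) (x j) = j - i)" if uv: "u \<in> V \<and> (u, v) \<in> E\<^sup>*" for u v
  proof -
    obtain x where x: "x 0 = u" "x (rdist E u v) = v"
      "\<forall>i j. i \<le> j \<longrightarrow> j \<le> rdist E u v \<longrightarrow> (x i, x j) \<in> E\<^sup>* \<and> rdist E (x i) (x j) = j - i"
      using rdist_geodesic[of u v E] uv by blast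
    have "x i \<in> V" if "i \<le> rdist E u v" for i
      using x(3)[rule_format, of 0 i] in_V[of u "x i"] x(1) uv that by blast
    then show ?thesis using x by (intro exI[of _ x]) auto
  qed
qed (use assms rdist_triangle in \<open>auto intro: rtrancl_trans\<close>)

lemma (in wf_digraph) shorter_apath:
  assumes "awalk u p v"
  shows "\<exists>q. apath u q v \<and> length q \<le> length p"
  using assms
proof (induction p rule: awalk_to_apath_induct)
  case (path p)
  then show ?case by (auto simp: apath_def)
next
  case (decomp p q r s)
  have "p = q @ r @ s"
    using awalk_cyc_decomp_has_prop[OF decomp(1,3)] decomp(2) by auto
  then have "length (q @ s) \<le> length p" by simp
  then show ?case using decomp(4) by (meson le_trans)
qed

section \<open>Hop distance and transitive closure of a digraph via relation powers\<close>

context pair_wf_digraph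
begin

lemma apath_relpow: "apath u p v \<Longrightarrow> (u, v) \<in> parcs G ^^ length p"
proof (induction p arbitrary: u)
  case (Cons e p)
  then have "e \<in> parcs G" "fst e = u" and IH: "(snd e, v) \<in> parcs G ^^ length p"
    by (auto simp: apath_Cons_iff)
  then have "(u, snd e) \<in> parcs G" by auto
  from relpow_Suc_I2[OF this IH] show ?case by simp
qed (auto simp: apath_Nil_iff)

lemma relpow_awalk:
  "(u, v) \<in> parcs G ^^ k \<Longrightarrow> u \<in> pverts G \<Longrightarrow> \<exists>p. awalk u p v \<and> length p = k"
proof (induction k arbitrary: u)
  case 0
  then show ?case by (intro exI[of _ "[]"]) (simp add: awalk_Nil_iff)
next
  case (Suc k)
  from Suc.prems(1) obtain w where w: "(u, w) \<in> parcs G" "(w, v) \<in> parcs G ^^ k" by (rule relpow_Suc_E2)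
  then have "w \<in> pverts G" using in_arcsD2 by auto
  from Suc.IH[OF w(2) this] obtain p where "awalk w p v" "length p = k" by blast
  then show ?case using w(1) by (intro exI[of _ "(u, w) # p"]) (auto simp: awalk_Cons_iff)
qed

text \<open>Deleting cycles turns a shortest walk into a path that is no longer, so minimising over
  paths or over walks gives the same value.\<close>

lemma hop_dist_eq_rdist:
  assumes "u \<in> pverts G" "(u, v) \<in> (parcs G)\<^sup>*"
  shows "hop_dist G u v = rdist (parcs G) u v"
proof -
  obtain p where p: "awalk u p v" "length p = rdist (parcs G) u v"
    using relpow_awalk[OF rdist_relpow[OF assms(2)] assms(1)] by blast
  obtain q where q: "apath u q v" "length q \<le> length p" using shorter_apath[OF p(1)] by blast
  show ?thesis unfolding hop_dist_def
  proof (rule Least_equality)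
    have "rdist (parcs G) u v \<le> length q" by (rule rdist_le[OF apath_relpow[OF q(1)]])
    then show "\<exists>p. apath u p v \<and> length p = rdist (parcs G) u v"
      using p(2) q by (intro exI[of _ q]) simp
  qed (auto intro: rdist_le apath_relpow)
qed

lemma TC_iff: "(u, v) \<in> TC G \<longleftrightarrow> u \<in> pverts G \<and> (u, v) \<in> (parcs G)\<^sup>*"
proof
  assume "(u, v) \<in> TC G"
  then have "u \<rightarrow>\<^sup>*\<^bsub>with_proj G\<^esub> v" by (simp add: TC_def)
  then obtain p where p: "apath u p v" using reachable_apath by blast
  then have "u \<in> pverts G" by (cases p) (auto simp: apath_Nil_iff apath_Cons_iff dest: in_arcsD1)
  then show "u \<in> pverts G \<and> (u, v) \<in> (parcs G)\<^sup>*"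
    using apath_relpow[OF p] by (auto intro: relpow_imp_rtrancl)
next
  assume "u \<in> pverts G \<and> (u, v) \<in> (parcs G)\<^sup>*"
  then obtain p where "awalk u p v" using relpow_awalk[OF rdist_relpow, of u v] by blast
  then show "(u, v) \<in> TC G" by (auto simp: TC_def reachable_awalk)
qed

lemma TC_in_pverts: "TC G \<subseteq> pverts G \<times> pverts G"
proof
  fix e assume "e \<in> TC G"
  then obtain u v where e: "e = (u, v)" "u \<in> pverts G" "(u, v) \<in> (parcs G)\<^sup>*"
    by (cases e) (auto simp: TC_iff)
  have "v \<in> pverts G"
    using e(3,2) by (induction rule: rtrancl_induct) (auto dest: in_arcsD2)
  then show "e \<in> pverts G \<times> pverts G" using e by simp
qed

end

section \<open>The potential and its decrease in a greedy step\<close>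

context pair_fin_digraph
begin

lemma finite_TC: "finite (TC G)"
  using finite_subset[OF TC_in_pverts] by simp

lemma add_edges_rtrancl: "H \<subseteq> TC G \<Longrightarrow> (parcs G \<union> H)\<^sup>* = (parcs G)\<^sup>*"
  by (rule rtrancl_subset) (auto simp: TC_iff subset_iff)

lemma add_edges_wf: "H \<subseteq> TC G \<Longrightarrow> pair_wf_digraph (add_edges G H)"
  using TC_in_pverts by unfold_locales (auto simp: add_edges_def dest: in_arcsD1 in_arcsD2)

lemma hop_dist_add_edges:
  assumes "H \<subseteq> TC G" "(u, v) \<in> TC G"
  shows "hop_dist (add_edges G H) u v = rdist (parcs G \<union> H) u v"
proof -
  interpret A: pair_wf_digraph "add_edges G H" by (rule add_edges_wf[OF assms(1)])
  show ?thesis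
    using A.hop_dist_eq_rdist[of u v] assms(2) add_edges_rtrancl[OF assms(1)]
    by (simp add: add_edges_def TC_iff)
qed

lemma hop_metric_add_edges:
  assumes "H \<subseteq> TC G"
  shows "hop_metric (pverts G) (\<lambda>u v. (u, v) \<in> TC G) (rdist (parcs G \<union> H))"
proof -
  have "parcs G \<union> H \<subseteq> pverts G \<times> pverts G"
    using TC_in_pverts assms by (auto dest: in_arcsD1 in_arcsD2)
  from hop_metric_rdist[OF _ this] show ?thesis
    using add_edges_rtrancl[OF assms] by (simp add: TC_iff)
qed

definition far :: "nat \<Rightarrow> ('a \<times> 'a) set \<Rightarrow> ('a \<times> 'a) set" where
  "far \<beta> H = {p \<in> TC G. \<beta> \<le> rdist (parcs G \<union> H) (fst p) (snd p)}"

lemma far_subset: "far \<beta> H \<subseteq> TC G"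
  by (auto simp: far_def)

lemma finite_far: "finite (far \<beta> H)"
  using finite_subset[OF far_subset finite_TC] .

lemma potential_eq:
  assumes "H \<subseteq> TC G"
  shows "potential G \<beta> H = (\<Sum>p\<in>far \<beta> H. rdist (parcs G \<union> H) (fst p) (snd p))"
proof -
  have "{(s, t). (s, t) \<in> TC G \<and> \<beta> \<le> hop_dist (add_edges G H) s t} = far \<beta> H"
    using hop_dist_add_edges[OF assms] by (auto simp: far_def)
  then show ?thesis unfolding potential_def
    using far_subset[of \<beta> H] by (intro sum.cong) (auto simp: hop_dist_add_edges[OF assms])
qed

abbreviation edge_gain :: "('a \<times> 'a) set \<Rightarrow> 'a \<times> 'a \<Rightarrow> 'a \<times> 'a \<Rightarrow> nat" where
  "edge_gain H \<equiv> hop_metric.gain (\<lambda>u v. (u, v) \<in> TC G) (rdist (parcs G \<union> H))"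

text \<open>Every pair gets closer by at least its gain. Pairs that fall below
  \<open>\<beta>\<close> leave the sum altogether, which decreases it further.\<close>

lemma potential_insert:
  assumes H: "H \<subseteq> TC G" and e: "e \<in> TC G"
  shows "potential G \<beta> (insert e H) + (\<Sum>p\<in>far \<beta> H. edge_gain H e p) \<le> potential G \<beta> H"
proof -
  interpret M: hop_metric "pverts G" "\<lambda>u v. (u, v) \<in> TC G" "rdist (parcs G \<union> H)"
    by (rule hop_metric_add_edges[OF H])
  let ?d = "\<lambda>p. rdist (parcs G \<union> H) (fst p) (snd p)"
  let ?d' = "\<lambda>p. rdist (parcs G \<union> insert e H) (fst p) (snd p)"
  have eH: "insert e H \<subseteq> TC G" using H e by simp
  have reach: "(u, v) \<in> (parcs G \<union> H)\<^sup>*" if "(u, v) \<in> TC G" for u v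
    using that add_edges_rtrancl[OF H] by (simp add: TC_iff)
  have le: "?d' p \<le> ?d p" if "p \<in> TC G" for p
    using that by (intro rdist_mono reach) auto
  then have sub: "far \<beta> (insert e H) \<subseteq> far \<beta> H" unfolding far_def using le_trans by blast
  have each: "?d' p + M.gain e p \<le> ?d p" if p: "p \<in> TC G" for p
  proof (cases "(fst p, fst e) \<in> TC G \<and> (snd e, snd p) \<in> TC G")
    case True
    have "?d' p \<le> rdist (parcs G \<union> H) (fst p) (fst e) + 1 + rdist (parcs G \<union> H) (snd e) (snd p)"
      using rdist_insert[of "fst p" "fst e" "parcs G \<union> H" "snd e" "snd p"] True reach by simp
    then show ?thesis using le[OF p] unfolding M.gain_def by auto
  next
    case False
    then have "M.gain e p = 0" unfolding M.gain_def by (rule if_not_P)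
    then show ?thesis using le[OF p] by simp
  qed
  have "potential G \<beta> (insert e H) = (\<Sum>p\<in>far \<beta> (insert e H). ?d' p)" by (rule potential_eq[OF eH])
  also have "\<dots> \<le> (\<Sum>p\<in>far \<beta> H. ?d' p)" by (rule sum_mono2[OF finite_far sub]) simp
  finally have "potential G \<beta> (insert e H) + (\<Sum>p\<in>far \<beta> H. M.gain e p)
      \<le> (\<Sum>p\<in>far \<beta> H. ?d' p + M.gain e p)" by (simp add: sum.distrib)
  also have "\<dots> \<le> (\<Sum>p\<in>far \<beta> H. ?d p)"
    by (rule sum_mono) (use each far_subset in blast)
  also have "\<dots> = potential G \<beta> H" by (rule potential_eq[OF H, symmetric])
  finally show ?thesis .
qed

text \<open>The greedy choice decreases the potential at least as much as any other edge, so
  \<open>e'\<close> can be chosen freely in the analysis.\<close>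

lemma greedy_step_potential:
  assumes step: "greedy_step G \<beta> H H'" and H: "H \<subseteq> TC G" and e': "e' \<in> TC G"
  shows "potential G \<beta> H' + (\<Sum>p\<in>far \<beta> H. edge_gain H e' p) \<le> potential G \<beta> H"
proof -
  let ?f = "\<lambda>e. int (potential G \<beta> H) - int (potential G \<beta> (insert e H))"
  from step obtain e where e: "is_arg_max ?f (\<lambda>e. e \<in> TC G) e" "H' = insert e H"
    unfolding greedy_step_def by blast
  have "\<not> ?f e < ?f e'" using e(1) e' unfolding is_arg_max_def by blast
  then have "potential G \<beta> H' \<le> potential G \<beta> (insert e' H)" using e(2) by simp
  then show ?thesis using potential_insert[OF H e', of \<beta>] by linarith
qed

lemma greedy_step_insert:
  assumes "greedy_step G \<beta> H H'"
  shows "\<exists>e. e \<in> TC G \<and> H' = insert e H"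
  using assms unfolding greedy_step_def is_arg_max_def by blast

lemma not_hopboundE:
  assumes "\<not> has_hopbound G \<beta> H" "H \<subseteq> TC G"
  obtains p where "p \<in> far \<beta> H" "\<beta> < rdist (parcs G \<union> H) (fst p) (snd p)"
proof -
  from assms(1) have "\<exists>p. p \<in> TC G \<and> \<beta> < hop_dist (add_edges G H) (fst p) (snd p)"
    unfolding has_hopbound_def split_beta Ball_def by (simp add: not_le)
  then obtain p where p: "p \<in> TC G" "\<beta> < hop_dist (add_edges G H) (fst p) (snd p)" by blast
  show thesis
    by (rule that[of p]) (use p hop_dist_add_edges[OF assms(2), of "fst p" "snd p"] in \<open>simp_all add: far_def\<close>)
qed

text \<open>A pair farther apart than \<open>\<beta> \<ge> 1\<close> has distance at least 2, so the
  edge joining it directly gains at least 1. This gives termination also for small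
  \<open>\<beta>\<close>, where \<open>shortening_edge\<close> does not apply.\<close>

lemma greedy_step_decreases:
  assumes step: "greedy_step G \<beta> H H'" and H: "H \<subseteq> TC G" and \<beta>: "\<beta> \<ge> 1"
  shows "potential G \<beta> H' < potential G \<beta> H"
proof -
  interpret M: hop_metric "pverts G" "\<lambda>u v. (u, v) \<in> TC G" "rdist (parcs G \<union> H)"
    by (rule hop_metric_add_edges[OF H])
  have nh: "\<not> has_hopbound G \<beta> H" using step by (simp add: greedy_step_def)
  note dec = greedy_step_potential[OF step H]
  obtain p where p: "p \<in> far \<beta> H" "\<beta> < rdist (parcs G \<union> H) (fst p) (snd p)"
    using not_hopboundE[OF nh H] .
  have pT: "p \<in> TC G" using p(1) far_subset by blast
  then have "fst p \<in> pverts G" "snd p \<in> pverts G" using TC_in_pverts by auto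
  then have "1 \<le> M.gain p p"
    using p(2) \<beta> M.T_refl M.d_refl by (simp add: M.gain_def)
  also have "\<dots> \<le> (\<Sum>p'\<in>far \<beta> H. M.gain p p')"
    by (rule member_le_sum[OF p(1)]) (auto simp: finite_far)
  finally show ?thesis using dec[OF pT] by linarith
qed

definition shrink :: "nat \<Rightarrow> real" where
  "shrink \<beta> = 1 / (3 * 2 ^ 41 * real (floor_log (card (pverts G)) + 2) ^ 9
     * size_bound (card (pverts G)) \<beta>)"

lemma greedy_step_shrinks:
  assumes step: "greedy_step G \<beta> H H'" and H: "H \<subseteq> TC G"
    and \<beta>: "8 * (floor_log (card (pverts G)) + 3) \<le> \<beta>"
  shows "real (potential G \<beta> H') \<le> (1 - shrink \<beta>) * real (potential G \<beta> H)"
proof -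
  interpret M: hop_metric "pverts G" "\<lambda>u v. (u, v) \<in> TC G" "rdist (parcs G \<union> H)"
    by (rule hop_metric_add_edges[OF H])
  have nh: "\<not> has_hopbound G \<beta> H" using step by (simp add: greedy_step_def)
  note dec = greedy_step_potential[OF step H]
  obtain p where "p \<in> far \<beta> H" using not_hopboundE[OF nh H] .
  then have ne: "far \<beta> H \<noteq> {}" by blast
  have "M.cheap (far \<beta> H) (shrink \<beta>) (far \<beta> H)"
    unfolding shrink_def
    by (rule M.shortening_edge[OF finite_far ne]) (use \<beta> in \<open>auto simp: far_def\<close>)
  then obtain e' where e': "e' \<in> TC G"
    "shrink \<beta> * (\<Sum>p\<in>far \<beta> H. real (rdist (parcs G \<union> H) (fst p) (snd p))) \<le> (\<Sum>p\<in>far \<beta> H. real (M.gain e' p))"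
    unfolding M.cheap_def by auto
  have "shrink \<beta> * real (potential G \<beta> H) \<le> real (\<Sum>p\<in>far \<beta> H. M.gain e' p)"
    using e'(2) by (simp add: potential_eq[OF H])
  moreover have "real (potential G \<beta> H' + (\<Sum>p\<in>far \<beta> H. M.gain e' p)) \<le> real (potential G \<beta> H)"
    using dec[OF e'(1)] by (rule of_nat_mono)
  ultimately show ?thesis by (simp add: algebra_simps)
qed

lemma greedy_run:
  assumes "(greedy_step G \<beta> ^^ j) {} H"
  shows "H \<subseteq> TC G \<and> card H \<le> j \<and> (8 * (floor_log (card (pverts G)) + 3) \<le> \<beta> \<longrightarrow>
    (shrink \<beta> \<le> 1 \<longrightarrow> real (potential G \<beta> H) \<le> (1 - shrink \<beta>) ^ j * real (potential G \<beta> {})))"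
  using assms
proof (induction j arbitrary: H)
  case (Suc j)
  from Suc.prems obtain K where K: "(greedy_step G \<beta> ^^ j) {} K" "greedy_step G \<beta> K H"
    by (rule relpowp_Suc_E)
  note IH = Suc.IH[OF K(1)]
  then have KT: "K \<subseteq> TC G" by blast
  obtain e where e: "e \<in> TC G" "H = insert e K" using greedy_step_insert[OF K(2)] by blast
  have "card H \<le> Suc j"
    using IH e(2) card_insert_le_m1[of "Suc j" K e] by simp
  moreover have "real (potential G \<beta> H) \<le> (1 - shrink \<beta>) ^ Suc j * real (potential G \<beta> {})"
    if b: "8 * (floor_log (card (pverts G)) + 3) \<le> \<beta>" and s: "shrink \<beta> \<le> 1"
  proof -
    have "real (potential G \<beta> H) \<le> (1 - shrink \<beta>) * real (potential G \<beta> K)"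
      by (rule greedy_step_shrinks[OF K(2) KT b])
    also have "\<dots> \<le> (1 - shrink \<beta>) * ((1 - shrink \<beta>) ^ j * real (potential G \<beta> {}))"
      using IH b s by (intro mult_left_mono) auto
    finally show ?thesis by simp
  qed
  ultimately show ?case using KT e by blast
qed simp

lemma greedy_terminates:
  assumes "\<beta> \<ge> 1"
  shows "greedy_terminates G \<beta>"
  unfolding greedy_terminates_def
proof
  assume "\<exists>S :: nat \<Rightarrow> ('a \<times> 'a) set. S 0 = {} \<and> (\<forall>i. greedy_step G \<beta> (S i) (S (Suc i)))"
  then obtain S where S: "S 0 = {}" "\<And>i. greedy_step G \<beta> (S i) (S (Suc i))" by blast
  have T: "S i \<subseteq> TC G" for i
  proof (induction i)
    case (Suc i)
    then show ?case using greedy_step_insert[OF S(2)[of i]] by auto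
  qed (simp add: S(1))
  have "potential G \<beta> (S i) + i \<le> potential G \<beta> (S 0)" for i
  proof (induction i)
    case (Suc i)
    then show ?case using greedy_step_decreases[OF S(2)[of i] T assms] by linarith
  qed simp
  from this[of "Suc (potential G \<beta> (S 0))"] show False by simp
qed

text \<open>A violated hopbound supplies a pair, so the transitive closure is nonempty; it is
  finite, hence a maximising edge exists and a step would be possible.\<close>

lemma final_has_hopbound:
  assumes H: "H \<subseteq> TC G" and stuck: "\<not> (\<exists>H'. greedy_step G \<beta> H H')"
  shows "has_hopbound G \<beta> H"
proof (rule ccontr)
  assume nh: "\<not> has_hopbound G \<beta> H"
  obtain p where "p \<in> far \<beta> H" using not_hopboundE[OF nh H] .
  then have ne: "TC G \<noteq> {}" using far_subset by blast
  let ?f = "\<lambda>e. int (potential G \<beta> H) - int (potential G \<beta> (insert e H))"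
  have "Max (?f ` TC G) \<in> ?f ` TC G" using ne finite_TC by (intro Max_in) auto
  then obtain e where e: "e \<in> TC G" "?f e = Max (?f ` TC G)" by auto
  have "is_arg_max ?f (\<lambda>e. e \<in> TC G) e"
    unfolding is_arg_max_def using e finite_TC by (auto simp: not_less)
  then have "greedy_step G \<beta> H (insert e H)" unfolding greedy_step_def using nh by blast
  then show False using stuck by blast
qed

lemma potential_le:
  assumes "H \<subseteq> TC G"
  shows "potential G \<beta> H \<le> card (pverts G) ^ 3"
proof -
  interpret M: hop_metric "pverts G" "\<lambda>u v. (u, v) \<in> TC G" "rdist (parcs G \<union> H)"
    by (rule hop_metric_add_edges[OF assms])
  have "card (far \<beta> H) \<le> card (pverts G \<times> pverts G)"
    using far_subset TC_in_pverts by (intro card_mono) auto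
  then have c: "card (far \<beta> H) \<le> card (pverts G) * card (pverts G)" by (simp add: card_cartesian_product)
  have "rdist (parcs G \<union> H) (fst p) (snd p) \<le> card (pverts G)" if "p \<in> far \<beta> H" for p
    using M.\<delta>_less[of "fst p" "snd p"] that by (simp add: far_def)
  then have "potential G \<beta> H \<le> card (far \<beta> H) * card (pverts G)"
    unfolding potential_eq[OF assms] using sum_bounded_above[of "far \<beta> H" _ "card (pverts G)"] by simp
  also have "\<dots> \<le> card (pverts G) * card (pverts G) * card (pverts G)" using c by simp
  finally show ?thesis by (simp add: power3_eq_cube mult.assoc)
qed

end

text \<open>From \<open>ln 2 \<ge> 1 / 2\<close> it follows that \<open>floor_log n\<close> is at
  most \<open>2 * ln n\<close> and that 3 is at most \<open>6 * ln n\<close>.\<close>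

lemma floor_log_le_ln:
  assumes "n \<ge> 2"
  shows "real (floor_log n + 3) \<le> 8 * ln (real n)"
proof -
  have l2: "ln (2 :: real) \<ge> 1/2"
    using ln_add_one_self_le_self2 ln_2_less_1 ln2_ge_two_thirds by linarith
  have "2 ^ floor_log n \<le> n" using assms by (intro floor_log_exp2_le) simp
  then have "real (2 ^ floor_log n) \<le> real n" by (rule of_nat_mono)
  then have "ln (2 ^ floor_log n) \<le> ln (real n)" using assms by (subst ln_le_cancel_iff) auto
  then have "real (floor_log n) * ln 2 \<le> ln (real n)" by (simp add: ln_realpow)
  moreover have "real (floor_log n) * (1/2) \<le> real (floor_log n) * ln 2"
    using l2 by (intro mult_left_mono) auto
  moreover have "ln 2 \<le> ln (real n)" using assms by simp
  ultimately show ?thesis using l2 by simp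
qed

section \<open>Correctness of the output and the number of iterations\<close>

context pair_fin_digraph
begin

lemma greedy_output_shortcut_set:
  assumes "greedy_output G \<beta> H"
  shows "shortcut_set G \<beta> H"
proof -
  obtain j where "(greedy_step G \<beta> ^^ j) {} H"
    using assms unfolding greedy_output_def by (blast dest: rtranclp_imp_relpowp)
  then have "H \<subseteq> TC G" using greedy_run by blast
  then show ?thesis
    using assms final_has_hopbound unfolding greedy_output_def shortcut_set_def by blast
qed

text \<open>Before the last of \<open>i + 1\<close> steps the potential is still at least 1, while
  it has shrunk \<open>i\<close> times from at most \<open>n ^ 3\<close>. This gives
  \<open>i \<le> 3 * ln n / \<sigma>\<close>.\<close>

lemma greedy_output_card:
  assumes out: "greedy_output G \<beta> H" and \<beta>: "\<beta> \<ge> 1"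
  defines "n \<equiv> card (pverts G)"
  shows "real (card H) \<le> (2 ^ 20 + 9 * 2 ^ 41 * 8 ^ 9) * ln (real n) ^ 10 * size_bound n \<beta>"
proof -
  obtain j where j: "(greedy_step G \<beta> ^^ j) {} H"
    using out unfolding greedy_output_def by (blast dest: rtranclp_imp_relpowp)
  have H: "H \<subseteq> TC G" "card H \<le> j" using greedy_run[OF j] by blast+
  show ?thesis
  proof (cases j)
    case 0
    have "0 \<le> ln (real n)" by (cases "n = 0") auto
    then show ?thesis using 0 H(2) by (simp add: size_bound_def)
  next
    case (Suc i)
    from j[unfolded Suc] obtain K where K: "(greedy_step G \<beta> ^^ i) {} K" "greedy_step G \<beta> K H"
      by (rule relpowp_Suc_E)
    note run = greedy_run[OF K(1)]
    then have KT: "K \<subseteq> TC G" by blast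
    interpret M: hop_metric "pverts G" "\<lambda>u v. (u, v) \<in> TC G" "rdist (parcs G \<union> K)"
      by (rule hop_metric_add_edges[OF KT])
    have "\<not> has_hopbound G \<beta> K" using K(2) by (simp add: greedy_step_def)
    then obtain p where p: "p \<in> far \<beta> K" "\<beta> < rdist (parcs G \<union> K) (fst p) (snd p)"
      using not_hopboundE KT by blast
    have "rdist (parcs G \<union> K) (fst p) (snd p) < n"
      using M.\<delta>_less[of "fst p" "snd p"] p(1) by (simp add: far_def n_def)
    then have \<beta>n: "\<beta> < n" using p(2) by linarith
    \<comment> \<open>That a step was made at all forces \<open>n \<ge> 2\<close>, so
      \<open>ln n\<close> is bounded away from 0 and can absorb constants.\<close>
    then have n2: "n \<ge> 2" using \<beta> by linarith
    define l where "l = ln (real n)"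
    have m: "real (floor_log n + 3) \<le> 8 * l" unfolding l_def by (rule floor_log_le_ln[OF n2])
    have l: "1 \<le> 4 * l" using m by simp
    have l0: "l \<ge> 0" using l by linarith
    have pos: "real n > 0" "real \<beta> > 0" using n2 \<beta> by auto
    have sb1: "1 \<le> size_bound n \<beta>"
    proof -
      have "1 \<le> real n powr (3/2) / real \<beta> powr (3/2)"
        using \<beta>n pos by (simp add: powr_mono2)
      moreover have "0 \<le> real n ^ 2 / real \<beta> ^ 3" by simp
      ultimately show ?thesis unfolding size_bound_def by linarith
    qed
    have "real (card H) \<le> (2 ^ 20 + 9 * 2 ^ 41 * 8 ^ 9) * (l ^ 10 * size_bound n \<beta>)"
    \<comment> \<open>For \<open>\<beta>\<close> below this logarithmic threshold, the trivial bound
      \<open>n\<^sup>2\<close> is already \<open>\<beta> ^ 3\<close> times the second term of the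
      claim.\<close>
    proof (cases "8 * (floor_log n + 3) \<le> \<beta>")
      case False
      have "card H \<le> card (pverts G \<times> pverts G)"
        using H(1) TC_in_pverts by (intro card_mono) auto
      then have "real (card H) \<le> real (n * n)"
        unfolding n_def card_cartesian_product by (rule of_nat_mono)
      also have "\<dots> = real \<beta> ^ 3 * (real n ^ 2 / real \<beta> ^ 3)"
        using pos by (simp add: power2_eq_square)
      also have "\<dots> \<le> (64 * l) ^ 3 * size_bound n \<beta>"
      proof (intro mult_mono power_mono)
        have "real \<beta> \<le> real (8 * (floor_log n + 3))" using False by (intro of_nat_mono) simp
        then show "real \<beta> \<le> 64 * l" using m by simp
      qed (auto simp: size_bound_def l0)
      \<comment> \<open>The factor \<open>1 ^ 7\<close> is replaced by \<open>(4 * l) ^ 7\<close> to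
        raise the exponent of \<open>l\<close> from 3 to 10.\<close>
      also have "(64 * l) ^ 3 = 64 ^ 3 * l ^ 3 * 1 ^ 7" by (simp add: power_mult_distrib)
      also have "64 ^ 3 * l ^ 3 * 1 ^ 7 \<le> 64 ^ 3 * l ^ 3 * (4 * l) ^ 7"
        using l l0 by (intro mult_left_mono power_mono) auto
      also have "64 ^ 3 * l ^ 3 * (4 * l) ^ 7 = 2 ^ 32 * l ^ 10"
        by (simp add: power_mult_distrib flip: power_add)
      finally have "real (card H) \<le> 2 ^ 32 * (l ^ 10 * size_bound n \<beta>)"
        using sb1 by (simp add: mult.assoc mult_right_mono)
      also have "\<dots> \<le> (2 ^ 20 + 9 * 2 ^ 41 * 8 ^ 9) * (l ^ 10 * size_bound n \<beta>)"
        using sb1 l0 by (intro mult_right_mono) auto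
      finally show ?thesis .
    next
      case True
      define \<sigma> where "\<sigma> = shrink \<beta>"
      let ?m = "real (floor_log n + 2)"
      have inv: "1 / \<sigma> = 3 * 2 ^ 41 * ?m ^ 9 * size_bound n \<beta>"
        by (simp add: \<sigma>_def shrink_def n_def)
      have "1 \<le> ?m ^ 9" by (intro one_le_power) simp
      then have "1 * 1 * 1 \<le> 3 * 2 ^ 41 * ?m ^ 9 * size_bound n \<beta>"
        using sb1 by (intro mult_mono) auto
      then have i1: "1 \<le> 1 / \<sigma>" using inv by simp
      then have \<sigma>: "0 < \<sigma>" "\<sigma> \<le> 1" by (simp_all add: le_divide_eq split: if_splits)
      have "1 \<le> (\<Sum>q\<in>far \<beta> K. rdist (parcs G \<union> K) (fst q) (snd q))"
        using member_le_sum[OF p(1), of "\<lambda>q. rdist (parcs G \<union> K) (fst q) (snd q)"] p(2) finite_far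
        by simp
      then have "1 \<le> potential G \<beta> K" by (simp add: potential_eq[OF KT])
      then have "1 \<le> real (potential G \<beta> K)" by simp
      also have "\<dots> \<le> (1 - \<sigma>) ^ i * real (potential G \<beta> {})"
        using run True \<sigma> by (simp add: n_def \<sigma>_def)
      also have "\<dots> \<le> exp (- \<sigma>) ^ i * real (n ^ 3)"
      proof (intro mult_mono power_mono of_nat_mono)
        show "1 - \<sigma> \<le> exp (- \<sigma>)" using exp_ge_add_one_self[of "- \<sigma>"] by simp
        show "potential G \<beta> {} \<le> n ^ 3" using potential_le[of "{}"] by (simp add: n_def)
      qed (use \<sigma> in auto)
      also have "exp (- \<sigma>) ^ i = exp (- (i * \<sigma>))" by (simp flip: exp_of_nat_mult)
      finally have "1 \<le> exp (- (i * \<sigma>)) * real (n ^ 3)" .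
      then have "ln 1 \<le> ln (exp (- (i * \<sigma>)) * real (n ^ 3))"
        using pos by (subst ln_le_cancel_iff) auto
      then have "i * \<sigma> \<le> 3 * l" using pos by (simp add: ln_mult ln_realpow l_def)
      then have "i \<le> 3 * l * (1 / \<sigma>)" using \<sigma> by (simp add: field_simps)
      also have "\<dots> \<le> 3 * l * (3 * 2 ^ 41 * (8 * l) ^ 9 * size_bound n \<beta>)"
        unfolding inv using m l0 sb1 by (intro mult_left_mono mult_right_mono power_mono) auto
      also have "\<dots> = 9 * 2 ^ 41 * 8 ^ 9 * (l ^ 10 * size_bound n \<beta>)"
        by (simp add: power_mult_distrib numeral_eq_Suc)
      finally have "real i \<le> 9 * 2 ^ 41 * 8 ^ 9 * (l ^ 10 * size_bound n \<beta>)" .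
      \<comment> \<open>Accounts for the last step, which the decay does not count; it is the source
        of the summand \<open>2 ^ 20\<close>.\<close>
      moreover have "1 ^ 10 * 1 \<le> (4 * l) ^ 10 * size_bound n \<beta>"
        using l l0 sb1 by (intro mult_mono power_mono) auto
      then have "1 \<le> 2 ^ 20 * (l ^ 10 * size_bound n \<beta>)" by (simp add: power_mult_distrib)
      moreover have "real (card H) \<le> 1 + real i" using H(2) Suc by simp
      ultimately show ?thesis unfolding distrib_right by linarith
    qed
    then show ?thesis by (simp add: l_def mult.assoc)
  qed
qed

end

theorem theorem1p1:
  shows "\<exists>(C :: real) (k :: nat). \<forall>(G :: 'a pair_pre_digraph) (n :: nat) (\<beta> :: nat).
    pair_fin_digraph G \<longrightarrow> card (pverts G) = n \<longrightarrow> \<beta> \<ge> 1 \<longrightarrow>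
      greedy_terminates G \<beta> \<and>
      (\<forall>H. greedy_output G \<beta> H \<longrightarrow>
         shortcut_set G \<beta> H \<and>
         real (card H) \<le> C * ln (real n) ^ k *
           (real n powr (3/2) / real \<beta> powr (3/2) + real n ^ 2 / real \<beta> ^ 3))"
proof (intro exI allI impI conjI)
  fix G :: "'a pair_pre_digraph" and n \<beta> :: nat
  assume G: "pair_fin_digraph G" and n: "card (pverts G) = n" and \<beta>: "1 \<le> \<beta>"
  interpret pair_fin_digraph G by (rule G)
  show "greedy_terminates G \<beta>" by (rule greedy_terminates[OF \<beta>])
  fix H assume H: "greedy_output G \<beta> H"
  show "shortcut_set G \<beta> H" by (rule greedy_output_shortcut_set[OF H])
  show "real (card H) \<le> (2 ^ 20 + 9 * 2 ^ 41 * 8 ^ 9) * ln (real n) ^ 10 *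
      (real n powr (3/2) / real \<beta> powr (3/2) + real n ^ 2 / real \<beta> ^ 3)"
    using greedy_output_card[OF H \<beta>] unfolding n size_bound_def .
qed

end
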